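(* Let $F$ be a field with $\mathrm{char}\,F\neq2$ and let $D$ be a unital composition division algebra over $F$ of dimension $d\in\{2,4,8\}$ with multiplicative quadratic norm $N_D:D\to F$. With $q_i$, $M$ as defined in the context, put $M_i=M(q_i)$, $$W_i=\{p\in U_i: N_D(q_i(p))\neq0\},\qquad X_D=\bigcup_{i=0}^dW_i\subseteq\mathbb P^d_F .$$ Then on the cover $\{W_i\}$ of $X_D$, the transition matrices $g_{ij}=M_iM_j^{-1}$ define an algebraic rank-$d$ vector bundle. This bundle is algebraically trivial.
   Context: A composition algebra over $F$ is a unital (not necessarily associative) $F$-algebra with a nondegenerate quadratic form $N_D$ satisfying $N_D(uv)=N_D(u)N_D(v)$. Fix an ordered $F$-basis $e_0,\dots,e_{d-1}$ of $D$; $M(u)$ is the matrix, in this basis, of left multiplication $L_u(v)=uv$ (its entries are linear in the coordinates of $u$, so $M(u)$ and $N_D(u)$ also make sense when the coordinates of $u$ lie in any commutative $F$-algebra). On $\mathbb P^d_F$ with homogeneous coordinates $[\alpha_0:\cdots:\alpha_d]$, $U_i=\{\alpha_i\ne0\}$ are the standard affine charts; with $\sigma_i:\{0,\dots,d-1\}\to\{0,\dots,d\}\setminus\{i\}$ the increasing bijection, the coordinate-deletion element on $U_i$ is $q_i=\sum_{r=0}^{d-1}\frac{\alpha_{\sigma_i(r)}}{\alpha_i}e_r$, an element of $D\otimes_F\mathcal O(U_i)$. $W_i$ is the open subscheme of $U_i$ where the regular function $N_D(q_i)$ is nonzero. *)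

theory Defs
  imports
    "HOL-Library.Poly_Mapping"
    "HOL-Library.Function_Algebras"
    "HOL-Library.FuncSet"
    "HOL-Computational_Algebra.Fraction_Field"
    "HOL-Algebra.Ideal"
    "HOL-Algebra.Module"
    "HOL-Analysis.Abstract_Topology"
    "Jordan_Normal_Form.Matrix"
begin

section \<open>Composition division algebras with an ordered basis\<close>

definition polar :: "('d::ab_group_add \<Rightarrow> 'f::field) \<Rightarrow> 'd \<Rightarrow> 'd \<Rightarrow> 'f" where
  "polar N u v = N (u + v) - N u - N v"

locale composition_algebra = vector_space scale
  for scale :: "'f::field \<Rightarrow> 'd::ab_group_add \<Rightarrow> 'd" +
  fixes mul :: "'d \<Rightarrow> 'd \<Rightarrow> 'd"
    and unit :: 'd
    and N :: "'d \<Rightarrow> 'f"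
  assumes mult_linear_right: "Vector_Spaces.linear scale scale (\<lambda>v. mul u v)"
    and mult_linear_left: "Vector_Spaces.linear scale scale (\<lambda>u. mul u v)"
    and unit_left: "mul unit u = u"
    and unit_right: "mul u unit = u"
    and norm_scale: "N (scale c u) = c ^ 2 * N u"
    and polar_linear: "Vector_Spaces.linear scale (*) (polar N u)"
    and nondegenerate: "(\<And>v. polar N u v = 0) \<Longrightarrow> u = 0"
    and norm_mult: "N (mul u v) = N u * N v"

locale composition_division_algebra = composition_algebra +
  assumes left_division: "a \<noteq> 0 \<Longrightarrow> bij (\<lambda>x. mul a x)"
    and right_division: "a \<noteq> 0 \<Longrightarrow> bij (\<lambda>x. mul x a)"

definition ordered_basis ::
  "('f::field \<Rightarrow> 'd::ab_group_add \<Rightarrow> 'd) \<Rightarrow> nat \<Rightarrow> (nat \<Rightarrow> 'd) \<Rightarrow> bool" where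
  "ordered_basis scale d e \<longleftrightarrow> inj_on e {..<d} \<and>
     \<not> module.dependent scale (e ` {..<d}) \<and> module.span scale (e ` {..<d}) = UNIV"

definition coord ::
  "('f::field \<Rightarrow> 'd::ab_group_add \<Rightarrow> 'd) \<Rightarrow> nat \<Rightarrow> (nat \<Rightarrow> 'd) \<Rightarrow> 'd \<Rightarrow> nat \<Rightarrow> 'f" where
  "coord scale d e v r = module.representation scale (e ` {..<d}) v (e r)"

text \<open>
  The matrix of left multiplication by, and the norm of, the element
  \<open>\<Sum>t<d. x t \<otimes> e t\<close> of \<open>D \<otimes> A\<close>, where \<open>A\<close> is a commutative algebra with structure map \<open>c\<close>.
  Matrices act on column vectors: column \<open>s\<close> holds the coordinates of the product with \<open>e s\<close>.
\<close>

definition left_mult_mat ::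
  "('f::field \<Rightarrow> 'd::ab_group_add \<Rightarrow> 'd) \<Rightarrow> ('d \<Rightarrow> 'd \<Rightarrow> 'd) \<Rightarrow> nat \<Rightarrow> (nat \<Rightarrow> 'd) \<Rightarrow>
   ('f \<Rightarrow> 'a::comm_ring_1) \<Rightarrow> (nat \<Rightarrow> 'a) \<Rightarrow> 'a mat" where
  "left_mult_mat scale mul d e c x =
     mat d d (\<lambda>(r, s). \<Sum>t<d. c (coord scale d e (mul (e t) (e s)) r) * x t)"

definition norm_ext ::
  "('d::ab_group_add \<Rightarrow> 'f::field) \<Rightarrow> nat \<Rightarrow> (nat \<Rightarrow> 'd) \<Rightarrow>
   ('f \<Rightarrow> 'a::comm_ring_1) \<Rightarrow> (nat \<Rightarrow> 'a) \<Rightarrow> 'a" where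
  "norm_ext N d e c x = (\<Sum>r<d. c (N (e r)) * x r ^ 2) +
     (\<Sum>s<d. \<Sum>r<s. c (polar N (e r) (e s)) * (x r * x s))"


section \<open>Projective space as a scheme\<close>

text \<open>
  The homogeneous coordinate ring is the polynomial ring in the variables \<open>0, \<dots>, d\<close>, a subring
  of the ring of polynomials in countably many variables. It is a domain, so all homogeneous
  localizations are realized inside one fraction field.
\<close>

type_synonym 'f hpoly = "(nat \<Rightarrow>\<^sub>0 nat) \<Rightarrow>\<^sub>0 'f"
type_synonym 'f ratf = "'f hpoly fract"
type_synonym 'f pt = "'f hpoly set"
type_synonym 'f regf = "'f pt \<Rightarrow> 'f ratf"

definition Var :: "nat \<Rightarrow> 'f::field hpoly" where
  "Var k = Poly_Mapping.single (Poly_Mapping.single k 1) 1"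

definition cst :: "'f::field \<Rightarrow> 'f ratf" where
  "cst c = Fraction_Field.Fract (Poly_Mapping.single 0 c) 1"

definition coord_ring :: "nat \<Rightarrow> 'f::field hpoly ring" where
  "coord_ring d = \<lparr>carrier = {p. \<forall>m \<in> Poly_Mapping.keys p. Poly_Mapping.keys m \<subseteq> {..d}},
     monoid.mult = (*), one = 1, zero = 0, add = (+)\<rparr>"

definition mdeg :: "(nat \<Rightarrow>\<^sub>0 nat) \<Rightarrow> nat" where
  "mdeg m = (\<Sum>k \<in> Poly_Mapping.keys m. Poly_Mapping.lookup m k)"

definition Hom :: "nat \<Rightarrow> nat \<Rightarrow> 'f::field hpoly set" where
  "Hom d n = {p \<in> carrier (coord_ring d). \<forall>m \<in> Poly_Mapping.keys p. mdeg m = n}"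

definition homogeneous_ideal :: "nat \<Rightarrow> 'f::field hpoly set \<Rightarrow> bool" where
  "homogeneous_ideal d I \<longleftrightarrow> ideal I (coord_ring d) \<and>
     (\<forall>p \<in> I. \<exists>h n. (\<forall>k. h k \<in> I \<inter> Hom d k) \<and> p = (\<Sum>k\<le>n. h k))"

definition Proj :: "nat \<Rightarrow> 'f::field pt set" where
  "Proj d = {P. homogeneous_ideal d P \<and> primeideal P (coord_ring d) \<and> \<not> Var ` {..d} \<subseteq> P}"

definition basic_open :: "nat \<Rightarrow> 'f::field hpoly \<Rightarrow> 'f pt set" where
  "basic_open d f = {P \<in> Proj d. f \<notin> P}"

definition zariski :: "nat \<Rightarrow> 'f::field pt topology" where
  "zariski d = topology_generated_by {basic_open d f | f. \<exists>n. f \<in> Hom d n}"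

definition chart :: "nat \<Rightarrow> nat \<Rightarrow> 'f::field pt set" where
  "chart d i = basic_open d (Var i)"

definition restrict_sec :: "'f::field pt set \<Rightarrow> 'f regf \<Rightarrow> 'f regf" where
  "restrict_sec V s = (\<lambda>P. if P \<in> V then s P else 0)"

text \<open>
  Sections over \<open>V\<close> assign to each point of \<open>V\<close> an element of the stalk there and are locally
  quotients of homogeneous elements of equal degree. They are extended by zero off \<open>V\<close>, so that
  the ring operations are the pointwise ones; the unit is the indicator of \<open>V\<close>.
\<close>

definition sections :: "nat \<Rightarrow> 'f::field pt set \<Rightarrow> 'f regf set" where
  "sections d V = {s. (\<forall>P. P \<notin> V \<longrightarrow> s P = 0) \<and>
     (\<forall>P \<in> V. \<exists>U a b n. openin (zariski d) U \<and> P \<in> U \<and> U \<subseteq> V \<and>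
        a \<in> Hom d n \<and> b \<in> Hom d n \<and> (\<forall>Q \<in> U. b \<notin> Q \<and> s Q = Fraction_Field.Fract a b))}"

definition struct_sheaf :: "nat \<Rightarrow> 'f::field pt set \<Rightarrow> 'f regf ring" where
  "struct_sheaf d V = \<lparr>carrier = sections d V, monoid.mult = (*), one = restrict_sec V 1,
     zero = 0, add = (+)\<rparr>"

definition stalk_max_ideal :: "nat \<Rightarrow> 'f::field pt \<Rightarrow> 'f ratf set" where
  "stalk_max_ideal d P =
     {Fraction_Field.Fract a b | a b n. a \<in> Hom d n \<and> b \<in> Hom d n \<and> a \<in> P \<and> b \<notin> P}"


section \<open>Sheaves of modules and vector bundles\<close>

record (overloaded) ('f, 'm) premod =
  sec :: "('f::field) pt set \<Rightarrow> ('f regf, 'm) module"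
  res :: "'f pt set \<Rightarrow> 'f pt set \<Rightarrow> 'm \<Rightarrow> 'm"

definition opens_in :: "nat \<Rightarrow> 'f::field pt set \<Rightarrow> 'f pt set set" where
  "opens_in d X = {V. openin (zariski d) V \<and> V \<subseteq> X}"

definition module_presheaf :: "nat \<Rightarrow> 'f::field pt set \<Rightarrow> ('f, 'm) premod \<Rightarrow> bool" where
  "module_presheaf d X E \<longleftrightarrow>
     (\<forall>V \<in> opens_in d X. Module.module (struct_sheaf d V) (sec E V)) \<and>
     (\<forall>V \<in> opens_in d X. \<forall>s \<in> carrier (sec E V). res E V V s = s) \<and>
     (\<forall>V \<in> opens_in d X. \<forall>V' \<in> opens_in d V.
        (\<forall>s \<in> carrier (sec E V). res E V V' s \<in> carrier (sec E V')) \<and>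
        (\<forall>s \<in> carrier (sec E V). \<forall>t \<in> carrier (sec E V).
           res E V V' (s \<oplus>\<^bsub>sec E V\<^esub> t) = res E V V' s \<oplus>\<^bsub>sec E V'\<^esub> res E V V' t) \<and>
        (\<forall>a \<in> sections d V. \<forall>s \<in> carrier (sec E V).
           res E V V' (a \<odot>\<^bsub>sec E V\<^esub> s) = restrict_sec V' a \<odot>\<^bsub>sec E V'\<^esub> res E V V' s) \<and>
        (\<forall>V'' \<in> opens_in d V'. \<forall>s \<in> carrier (sec E V).
           res E V' V'' (res E V V' s) = res E V V'' s))"

definition module_sheaf :: "nat \<Rightarrow> 'f::field pt set \<Rightarrow> ('f, 'm) premod \<Rightarrow> bool" where
  "module_sheaf d X E \<longleftrightarrow> module_presheaf d X E \<and>
     (\<forall>\<V> s. \<V> \<subseteq> opens_in d X \<longrightarrow> (\<forall>V \<in> \<V>. s V \<in> carrier (sec E V)) \<longrightarrow>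
        (\<forall>V \<in> \<V>. \<forall>V' \<in> \<V>. res E V (V \<inter> V') (s V) = res E V' (V \<inter> V') (s V')) \<longrightarrow>
        (\<exists>!t. t \<in> carrier (sec E (\<Union>\<V>)) \<and> (\<forall>V \<in> \<V>. res E (\<Union>\<V>) V t = s V)))"

definition module_iso ::
  "nat \<Rightarrow> 'f::field pt set \<Rightarrow> ('f, 'm) premod \<Rightarrow> ('f, 'n) premod \<Rightarrow> bool" where
  "module_iso d X E E' \<longleftrightarrow> (\<exists>\<phi>.
     (\<forall>V \<in> opens_in d X. bij_betw (\<phi> V) (carrier (sec E V)) (carrier (sec E' V)) \<and>
        (\<forall>s \<in> carrier (sec E V). \<forall>t \<in> carrier (sec E V).
           \<phi> V (s \<oplus>\<^bsub>sec E V\<^esub> t) = \<phi> V s \<oplus>\<^bsub>sec E' V\<^esub> \<phi> V t) \<and>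
        (\<forall>a \<in> sections d V. \<forall>s \<in> carrier (sec E V).
           \<phi> V (a \<odot>\<^bsub>sec E V\<^esub> s) = a \<odot>\<^bsub>sec E' V\<^esub> \<phi> V s) \<and>
        (\<forall>V' \<in> opens_in d V. \<forall>s \<in> carrier (sec E V).
           \<phi> V' (res E V V' s) = res E' V V' (\<phi> V s))))"

definition restrict_vec :: "'f::field pt set \<Rightarrow> 'f regf vec \<Rightarrow> 'f regf vec" where
  "restrict_vec V = map_vec (restrict_sec V)"

definition free_module :: "nat \<Rightarrow> nat \<Rightarrow> ('f::field, 'f regf vec) premod" where
  "free_module d r =
     \<lparr>sec = (\<lambda>V. \<lparr>carrier = {v \<in> carrier_vec r. \<forall>k<r. v $ k \<in> sections d V},
        monoid.mult = undefined, one = undefined, zero = 0\<^sub>v r, add = (+), smult = (\<cdot>\<^sub>v)\<rparr>),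
      res = (\<lambda>V V'. restrict_vec V')\<rparr>"

definition vector_bundle :: "nat \<Rightarrow> 'f::field pt set \<Rightarrow> nat \<Rightarrow> ('f, 'm) premod \<Rightarrow> bool" where
  "vector_bundle d X r E \<longleftrightarrow> module_sheaf d X E \<and>
     (\<forall>P \<in> X. \<exists>V \<in> opens_in d X. P \<in> V \<and> module_iso d V E (free_module d r))"

definition trivial_bundle :: "nat \<Rightarrow> 'f::field pt set \<Rightarrow> nat \<Rightarrow> ('f, 'm) premod \<Rightarrow> bool" where
  "trivial_bundle d X r E \<longleftrightarrow> module_iso d X E (free_module d r)"

definition restrict_mat :: "'f::field pt set \<Rightarrow> 'f regf mat \<Rightarrow> 'f regf mat" where
  "restrict_mat V = map_mat (restrict_sec V)"

definition sections_mat :: "nat \<Rightarrow> 'f::field pt set \<Rightarrow> nat \<Rightarrow> 'f regf mat set" where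
  "sections_mat d V r =
     {A \<in> carrier_mat r r. \<forall>k<r. \<forall>l<r. A $$ (k, l) \<in> sections d V}"

definition GL :: "nat \<Rightarrow> 'f::field pt set \<Rightarrow> nat \<Rightarrow> 'f regf mat set" where
  "GL d V r = {A \<in> sections_mat d V r. \<exists>B \<in> sections_mat d V r.
     A * B = restrict_mat V (1\<^sub>m r) \<and> B * A = restrict_mat V (1\<^sub>m r)}"

definition cocycle ::
  "nat \<Rightarrow> nat set \<Rightarrow> (nat \<Rightarrow> 'f::field pt set) \<Rightarrow> nat \<Rightarrow> (nat \<Rightarrow> nat \<Rightarrow> 'f regf mat) \<Rightarrow> bool" where
  "cocycle d I W r g \<longleftrightarrow>
     (\<forall>i \<in> I. \<forall>j \<in> I. g i j \<in> GL d (W i \<inter> W j) r) \<and>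
     (\<forall>i \<in> I. g i i = restrict_mat (W i) (1\<^sub>m r)) \<and>
     (\<forall>i \<in> I. \<forall>j \<in> I. \<forall>k \<in> I.
        restrict_mat (W i \<inter> W j \<inter> W k) (g i j * g j k) =
        restrict_mat (W i \<inter> W j \<inter> W k) (g i k))"

text \<open>
  The sheaf of sections of the bundle glued from trivial bundles on the \<open>W i\<close>, where \<open>g i j\<close>
  takes coordinates over \<open>W j\<close> to coordinates over \<open>W i\<close>.
\<close>

definition glued_bundle ::
  "nat \<Rightarrow> nat set \<Rightarrow> (nat \<Rightarrow> 'f::field pt set) \<Rightarrow> nat \<Rightarrow> (nat \<Rightarrow> nat \<Rightarrow> 'f regf mat) \<Rightarrow>
   ('f, nat \<Rightarrow> 'f regf vec) premod" where
  "glued_bundle d I W r g =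
     \<lparr>sec = (\<lambda>V. \<lparr>carrier =
          {s \<in> (\<Pi>\<^sub>E i\<in>I. carrier (sec (free_module d r) (V \<inter> W i))).
            \<forall>i \<in> I. \<forall>j \<in> I. restrict_vec (V \<inter> W i \<inter> W j) (s i) =
              restrict_vec (V \<inter> W i \<inter> W j) (g i j *\<^sub>v s j)},
        monoid.mult = undefined, one = undefined, zero = (\<lambda>i\<in>I. 0\<^sub>v r),
        add = (\<lambda>s t. \<lambda>i\<in>I. s i + t i), smult = (\<lambda>a s. \<lambda>i\<in>I. a \<cdot>\<^sub>v s i)\<rparr>),
      res = (\<lambda>V V' s. \<lambda>i\<in>I. restrict_vec V' (s i))\<rparr>"


section \<open>The bundle attached to a composition division algebra\<close>

definition skip :: "nat \<Rightarrow> nat \<Rightarrow> nat" where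
  "skip i r = (if r < i then r else Suc r)"

text \<open>
  The ring of functions on a chart embeds in the fraction field, where the coordinates of the
  deletion element live. A regular function is nonzero at a point iff its germ there lies outside
  the maximal ideal of the stalk, i.e. iff its value in the residue field is nonzero.
\<close>

definition deletion :: "nat \<Rightarrow> nat \<Rightarrow> 'f::field ratf" where
  "deletion i r = Fraction_Field.Fract (Var (skip i r)) (Var i)"

definition M_del ::
  "('f::field \<Rightarrow> 'd::ab_group_add \<Rightarrow> 'd) \<Rightarrow> ('d \<Rightarrow> 'd \<Rightarrow> 'd) \<Rightarrow> nat \<Rightarrow> (nat \<Rightarrow> 'd) \<Rightarrow>
   nat \<Rightarrow> 'f ratf mat" where
  "M_del scale mul d e i = left_mult_mat scale mul d e cst (deletion i)"

definition W_del ::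
  "('d::ab_group_add \<Rightarrow> 'f::field) \<Rightarrow> nat \<Rightarrow> (nat \<Rightarrow> 'd) \<Rightarrow> nat \<Rightarrow> 'f pt set" where
  "W_del N d e i = {P \<in> chart d i. norm_ext N d e cst (deletion i) \<notin> stalk_max_ideal d P}"

definition X_del ::
  "('d::ab_group_add \<Rightarrow> 'f::field) \<Rightarrow> nat \<Rightarrow> (nat \<Rightarrow> 'd) \<Rightarrow> 'f pt set" where
  "X_del N d e = (\<Union>i\<le>d. W_del N d e i)"

definition section_mat :: "'f::field pt set \<Rightarrow> 'f ratf mat \<Rightarrow> 'f regf mat" where
  "section_mat V = map_mat (\<lambda>f. restrict_sec V (\<lambda>_. f))"

definition transition ::
  "('f::field \<Rightarrow> 'd::ab_group_add \<Rightarrow> 'd) \<Rightarrow> ('d \<Rightarrow> 'd \<Rightarrow> 'd) \<Rightarrow> ('d \<Rightarrow> 'f) \<Rightarrow> nat \<Rightarrow>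
   (nat \<Rightarrow> 'd) \<Rightarrow> nat \<Rightarrow> nat \<Rightarrow> 'f regf mat" where
  "transition scale mul N d e i j =
     section_mat (W_del N d e i \<inter> W_del N d e j)
       (M_del scale mul d e i *
        inv\<^bsub>ring_mat TYPE('f ratf) d ()\<^esub> (M_del scale mul d e j))"

end

theory Submission
  imports Defs "Jordan_Normal_Form.Determinant"
begin

text \<open>
  The transition matrices are presented as a coboundary: \<open>g i j\<close> is the matrix \<open>M i\<close> times the inverse
  of \<open>M j\<close>, where \<open>M i\<close> lives on all of \<open>W i\<close> and not only on overlaps. If \<open>M i\<close> is invertible over the ring
  of regular functions on \<open>W i\<close>, then a compatible family of local coordinate vectors \<open>s i\<close> yields vectors
  \<open>inverse (M i) * s i\<close> that agree on overlaps, hence a single global coordinate vector, and the bundle is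
  trivial. The cocycle identities are a telescoping computation, and local triviality is witnessed
  by the whole space \<open>X\<close>.

  The point is therefore the invertibility of \<open>M i\<close>. Let \<open>B\<close> be the Gram matrix of the polar form of the
  norm in the basis \<open>e\<close>. Polarizing the composition law shows that left multiplication is a similitude
  of that form: \<open>transpose M * B * M = n * B\<close>, where \<open>n\<close> is the norm of the generic element
  (lemma \<open>left_mult_similitude\<close>). The form is nondegenerate, so \<open>B\<close> is invertible over the base field, and
  \<open>inverse n * inverse B * transpose M * B\<close> is inverse to \<open>M\<close> (lemma \<open>similitude_inverse\<close>). Its entries are
  regular wherever \<open>n\<close> is invertible, and \<open>W i\<close> is by definition the locus in the chart where the norm
  of the deletion element does not vanish (lemma \<open>fraction_on_inverse\<close>).

  That the norm of the deletion element is not the zero function follows from anisotropy of the norm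
  of a division algebra (lemmas \<open>norm_nonzero\<close> and \<open>norm_deletion_nonzero\<close>). The sheaf axioms for the glued
  module and the passage to the global frame have nothing to do with algebras; they are the lemmas
  \<open>glued_sheaf\<close> and \<open>coboundary_trivial\<close>.
\<close>

section \<open>Left multiplication as a similitude of the norm form\<close>

lemma polar_commute: "polar N u v = polar N v u"
  by (simp add: polar_def add.commute)

context composition_algebra
begin

lemma polar_hom: "module_hom scale (*) (polar N u)"
  using polar_linear by (rule Vector_Spaces.linear.axioms(3))

lemmas polar_add_right = module_hom.add[OF polar_hom]
lemmas polar_scale_right = module_hom.scale[OF polar_hom]
lemmas polar_sum_right = module_hom.sum[OF polar_hom]

lemmas mul_add_right = module_hom.add[OF Vector_Spaces.linear.axioms(3)[OF mult_linear_right]]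
lemmas mul_add_left = module_hom.add[OF Vector_Spaces.linear.axioms(3)[OF mult_linear_left]]

lemma polar_sum_scale:
  "polar N (\<Sum>r\<in>R. scale (a r) (e r)) (\<Sum>r\<in>R'. scale (b r) (e r)) =
   (\<Sum>r\<in>R. \<Sum>r'\<in>R'. a r * polar N (e r) (e r') * b r')"
proof -
  have "polar N (\<Sum>r\<in>R. scale (a r) (e r)) w = (\<Sum>r\<in>R. a r * polar N (e r) w)" for w
    by (simp add: polar_commute[of N _ w] polar_sum_right polar_scale_right)
  then show ?thesis
    by (simp add: polar_sum_right polar_scale_right sum_distrib_left mult_ac sum.swap[of _ R'])
qed

lemma polar_mul_same: "polar N (mul u v) (mul u w) = N u * polar N v w"
  unfolding polar_def mul_add_right[symmetric] norm_mult
  by (simp add: algebra_simps)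

text \<open>
  Polarizing \<open>N (u v) = N u * N v\<close> in both arguments. Once the identities are bilinear they
  can be checked on a basis, and so they persist for coordinates in any commutative algebra, also
  when \<open>F\<close> is finite and a polynomial is not determined by its values.
\<close>

lemma polar_mul_exchange:
  "polar N (mul u v) (mul u' w) + polar N (mul u' v) (mul u w) = polar N u u' * polar N v w"
proof -
  have "polar N (mul (u + u') v) (mul (u + u') w) =
      polar N (mul u v) (mul u w) + polar N (mul u v) (mul u' w) +
      (polar N (mul u' v) (mul u w) + polar N (mul u' v) (mul u' w))"
    by (simp add: mul_add_left polar_add_right
        polar_commute[of N "_ + _"] polar_commute[of N _ "mul u v"] polar_commute[of N _ "mul u' v"])
  then show ?thesis
    unfolding polar_mul_same polar_def[of N u u'] by (simp add: algebra_simps)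
qed

end

text \<open>
  An isotropic \<open>u\<close> would make the norm vanish on \<open>u D\<close>, which is all of \<open>D\<close> by division.
\<close>

lemma (in composition_division_algebra) norm_nonzero:
  assumes "u \<noteq> 0"
  shows "N u \<noteq> 0"
proof
  assume "N u = 0"
  have "N v = 0" for v
  proof -
    obtain w where "v = mul u w"
      using left_division[OF assms] by (metis bij_pointE)
    then show ?thesis
      by (simp add: norm_mult \<open>N u = 0\<close>)
  qed
  then have "polar N u v = 0" for v
    by (simp add: polar_def)
  then show False
    using nondegenerate assms by blast
qed

lemma ordered_basis_expansion:
  assumes "vector_space scale" and "ordered_basis scale d e"
  shows "(\<Sum>r<d. scale (coord scale d e v r) (e r)) = v"
proof -
  interpret vector_space scale by fact
  have "(\<Sum>b\<in>e ` {..<d}. scale (representation (e ` {..<d}) v b) b) = v"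
    using assms(2) by (intro sum_representation_eq) (auto simp: ordered_basis_def)
  then show ?thesis
    using assms(2) by (simp add: coord_def ordered_basis_def sum.reindex)
qed

lemma ordered_basis_unique:
  assumes "vector_space scale" and "ordered_basis scale d e"
    and "(\<Sum>r<d. scale (a r) (e r)) = 0" and "r < d"
  shows "a r = 0"
proof -
  interpret vector_space scale by fact
  have inj: "inj_on e {..<d}" and ind: "independent (e ` {..<d})"
    using assms(2) by (auto simp: ordered_basis_def)
  have "(\<Sum>b\<in>e ` {..<d}. scale (a (inv_into {..<d} e b)) b) = 0"
    using assms(3) inj by (simp add: sum.reindex inv_into_f_f)
  then have "a (inv_into {..<d} e (e r)) = 0"
    by (rule independentD[OF ind _ subset_refl, rotated]) (use assms(4) in auto)
  then show ?thesis
    using inj assms(4) by (simp add: inv_into_f_f)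
qed

definition gram_mat :: "('d::ab_group_add \<Rightarrow> 'f::field) \<Rightarrow> nat \<Rightarrow> (nat \<Rightarrow> 'd) \<Rightarrow> 'f mat" where
  "gram_mat N d e = mat d d (\<lambda>(r, s). polar N (e r) (e s))"

lemma gram_mat_carrier [simp]: "gram_mat N d e \<in> carrier_mat d d"
  by (simp add: gram_mat_def)

lemma left_mult_mat_carrier [simp]: "left_mult_mat scale mul d e c x \<in> carrier_mat d d"
  by (simp add: left_mult_mat_def)

lemma (in composition_algebra) gram_mat_invertible:
  assumes basis: "ordered_basis scale d e"
  obtains C where "C \<in> carrier_mat d d" and "C * gram_mat N d e = 1\<^sub>m d"
proof -
  let ?B = "gram_mat N d e"
  have "det ?B \<noteq> 0"
  proof
    assume "det ?B = 0"
    then obtain v where v: "v \<in> carrier_vec d" "v \<noteq> 0\<^sub>v d" "?B *\<^sub>v v = 0\<^sub>v d"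
      using det_0_iff_vec_prod_zero_field[OF gram_mat_carrier] by blast
    define u where "u = (\<Sum>r<d. scale (v $ r) (e r))"
    have orth: "polar N (e s) u = 0" if "s < d" for s
    proof -
      have "(?B *\<^sub>v v) $ s = (\<Sum>r<d. polar N (e s) (e r) * v $ r)"
        using that v(1) by (simp add: gram_mat_def scalar_prod_def atLeast0LessThan)
      then show ?thesis
        using v(3) that by (simp add: u_def polar_sum_right polar_scale_right mult.commute)
    qed
    have "polar N u w = 0" for w
    proof -
      have "polar N u w = polar N u (\<Sum>s<d. scale (coord scale d e w s) (e s))"
        using ordered_basis_expansion[OF vector_space_axioms basis] by simp
      also have "\<dots> = 0"
        unfolding polar_sum_right polar_scale_right
        using orth by (simp add: polar_commute[of N u])
      finally show ?thesis .
    qed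
    then have "u = 0"
      by (rule nondegenerate)
    then have "v $ r = 0" if "r < d" for r
      using ordered_basis_unique[OF vector_space_axioms basis _ that] by (simp add: u_def)
    then show False
      using v(1,2) by auto
  qed
  from det_non_zero_imp_unit[OF gram_mat_carrier this, of "()"]
  show ?thesis
    using that by (auto simp: Units_def ring_mat_simps)
qed

text \<open>
  The off-diagonal terms are paired as in the sum that defines the norm of a generic element.
\<close>

lemma sum_square_split:
  fixes f :: "nat \<Rightarrow> nat \<Rightarrow> 'a::comm_monoid_add"
  shows "(\<Sum>s<d. \<Sum>r<d. f r s) = (\<Sum>r<d. f r r) + (\<Sum>s<d. \<Sum>r<s. f r s + f s r)"
  by (induction d) (simp_all add: sum.distrib ac_simps)

text \<open>
  Left multiplication by \<open>u\<close> multiplies the polar form by the factor \<open>N u\<close>. For a generic \<open>u\<close>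
  the coefficient of \<open>x t ^ 2\<close> on the left is governed by the polarization in the right factor, that
  of \<open>x r * x s\<close> by the polarization in both factors.
\<close>

lemma (in composition_algebra) left_mult_similitude:
  fixes c :: "'f \<Rightarrow> 'k::comm_ring_1" and x :: "nat \<Rightarrow> 'k"
  assumes hom: "comm_ring_hom c" and basis: "ordered_basis scale d e"
  defines "M \<equiv> left_mult_mat scale mul d e c x"
    and "B \<equiv> map_mat c (gram_mat N d e)"
  shows "M\<^sup>T * (B * M) = norm_ext N d e c x \<cdot>\<^sub>m B"
proof -
  interpret c: comm_ring_hom c by fact
  have M: "M \<in> carrier_mat d d" and B: "B \<in> carrier_mat d d"
    by (auto simp: M_def B_def)
  define m where "m t s r = coord scale d e (mul (e t) (e s)) r" for t s r
  define Q where "Q t p t' q = polar N (mul (e t) (e p)) (mul (e t') (e q))" for t p t' q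
  have Q: "Q t p t' q = (\<Sum>r<d. \<Sum>r'<d. m t p r * polar N (e r) (e r') * m t' q r')" for t p t' q
    unfolding m_def Q_def polar_sum_scale[symmetric]
      ordered_basis_expansion[OF vector_space_axioms basis] ..
  have "(M\<^sup>T * (B * M)) $$ (p, q) = norm_ext N d e c x * B $$ (p, q)"
    if pq: "p < d" "q < d" for p q
  proof -
    have "(M\<^sup>T * (B * M)) $$ (p, q) =
        (\<Sum>r<d. (\<Sum>t<d. c (m t p r) * x t) *
          (\<Sum>r'<d. c (polar N (e r) (e r')) * (\<Sum>t'<d. c (m t' q r') * x t')))"
      using pq by (simp add: M_def B_def left_mult_mat_def gram_mat_def scalar_prod_def
          atLeast0LessThan m_def)
    also have "\<dots> = (\<Sum>r<d. \<Sum>r'<d. \<Sum>t'<d. \<Sum>t<d.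
        c (m t p r * polar N (e r) (e r') * m t' q r') * (x t * x t'))"
      by (simp add: sum_distrib_left sum_distrib_right c.hom_mult ac_simps)
    also have "\<dots> = (\<Sum>r<d. \<Sum>t'<d. \<Sum>r'<d. \<Sum>t<d.
        c (m t p r * polar N (e r) (e r') * m t' q r') * (x t * x t'))"
      by (intro sum.cong refl sum.swap)
    also have "\<dots> = (\<Sum>t'<d. \<Sum>r<d. \<Sum>r'<d. \<Sum>t<d.
        c (m t p r * polar N (e r) (e r') * m t' q r') * (x t * x t'))"
      by (rule sum.swap)
    also have "\<dots> = (\<Sum>t'<d. \<Sum>r<d. \<Sum>t<d. \<Sum>r'<d.
        c (m t p r * polar N (e r) (e r') * m t' q r') * (x t * x t'))"
      by (intro sum.cong refl sum.swap)
    also have "\<dots> = (\<Sum>t'<d. \<Sum>t<d. \<Sum>r<d. \<Sum>r'<d.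
        c (m t p r * polar N (e r) (e r') * m t' q r') * (x t * x t'))"
      by (intro sum.cong refl sum.swap)
    also have "\<dots> = (\<Sum>t'<d. \<Sum>t<d. c (Q t p t' q) * (x t * x t'))"
      by (simp add: Q c.hom_sum sum_distrib_right)
    also have "\<dots> = (\<Sum>t<d. c (Q t p t q) * (x t * x t)) +
        (\<Sum>s<d. \<Sum>r<s. c (Q r p s q) * (x r * x s) + c (Q s p r q) * (x s * x r))"
      by (rule sum_square_split)
    also have "\<dots> = (\<Sum>t<d. c (N (e t)) * x t ^ 2 * c (polar N (e p) (e q))) +
        (\<Sum>s<d. \<Sum>r<s. c (polar N (e r) (e s)) * (x r * x s) * c (polar N (e p) (e q)))"
    proof -
      have diag: "c (Q t p t q) * (x t * x t) = c (N (e t)) * x t ^ 2 * c (polar N (e p) (e q))" for t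
        by (simp add: Q_def polar_mul_same c.hom_mult power2_eq_square ac_simps)
      \<comment> \<open>the two mixed terms are not determined separately, only their sum is\<close>
      have "c (Q r p s q) * (x r * x s) + c (Q s p r q) * (x s * x r) =
          c (Q r p s q + Q s p r q) * (x r * x s)" for r s
        by (simp add: c.hom_add algebra_simps)
      then have "c (Q r p s q) * (x r * x s) + c (Q s p r q) * (x s * x r) =
          c (polar N (e r) (e s)) * (x r * x s) * c (polar N (e p) (e q))" for r s
        by (simp add: Q_def polar_mul_exchange c.hom_mult ac_simps)
      then show ?thesis
        by (simp only: diag)
    qed
    also have "\<dots> = norm_ext N d e c x * B $$ (p, q)"
      using pq by (simp add: norm_ext_def B_def gram_mat_def sum_distrib_right distrib_right)
    finally show ?thesis .
  qed
  then show ?thesis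
    using M B by (intro eq_matI) auto
qed

section \<open>Regular functions on open subsets of projective space\<close>

lemma coord_ring_simps [simp]:
  "monoid.mult (coord_ring d) = (*)" "add (coord_ring d) = (+)"
  "one (coord_ring d) = 1" "zero (coord_ring d) = 0"
  by (simp_all add: coord_ring_def)

lemma mdeg_superset:
  assumes "finite K" and "Poly_Mapping.keys m \<subseteq> K"
  shows "mdeg m = (\<Sum>k\<in>K. Poly_Mapping.lookup m k)"
  unfolding mdeg_def using assms
  by (intro sum.mono_neutral_left) (auto simp: in_keys_iff)

lemma mdeg_add: "mdeg (m + m') = mdeg m + mdeg m'"
proof -
  let ?K = "Poly_Mapping.keys m \<union> Poly_Mapping.keys m'"
  have "mdeg (m + m') = (\<Sum>k\<in>?K. Poly_Mapping.lookup (m + m') k)"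
    using keys_add[of m m'] by (intro mdeg_superset) auto
  also have "\<dots> = mdeg m + mdeg m'"
    by (simp add: lookup_add sum.distrib mdeg_superset[of ?K m] mdeg_superset[of ?K m'])
  finally show ?thesis .
qed

lemma Hom_subset: "Hom d n \<subseteq> carrier (coord_ring d)"
  by (auto simp: Hom_def)

lemma Hom_const: "Poly_Mapping.single 0 c \<in> Hom d 0"
  by (simp add: Hom_def coord_ring_def mdeg_def)

lemma Hom_one: "1 \<in> Hom d 0"
  using Hom_const[of 1] by simp

lemma Hom_Var: "k \<le> d \<Longrightarrow> Var k \<in> Hom d 1"
  by (simp add: Hom_def coord_ring_def mdeg_def Var_def)

lemma Hom_add: "p \<in> Hom d n \<Longrightarrow> q \<in> Hom d n \<Longrightarrow> p + q \<in> Hom d n"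
  using keys_add[of p q] unfolding Hom_def coord_ring_def by simp blast

lemma Hom_mult:
  assumes "p \<in> Hom d n" and "q \<in> Hom d n'"
  shows "p * q \<in> Hom d (n + n')"
proof -
  have "Poly_Mapping.keys m \<subseteq> {..d} \<and> mdeg m = n + n'" if "m \<in> Poly_Mapping.keys (p * q)" for m
  proof -
    obtain a b where "m = a + b" "a \<in> Poly_Mapping.keys p" "b \<in> Poly_Mapping.keys q"
      using \<open>m \<in> _\<close> keys_mult[of p q] by auto
    then show ?thesis
      using assms keys_add[of a b] by (fastforce simp: Hom_def coord_ring_def mdeg_add)
  qed
  then show ?thesis
    by (auto simp: Hom_def coord_ring_def)
qed

context
  fixes d :: nat and P :: "'f::field pt"
  assumes P: "P \<in> Proj d"
begin

interpretation primeideal P "coord_ring d"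
  using P by (simp add: Proj_def)

lemma Proj_zero: "0 \<in> P"
  using additive_subgroup.zero_closed[OF is_additive_subgroup] by simp

lemma Proj_one: "1 \<notin> P"
  using one_imp_carrier I_notcarr by auto

lemma Proj_mult_iff:
  assumes "a \<in> Hom d n" and "b \<in> Hom d n'"
  shows "a * b \<in> P \<longleftrightarrow> a \<in> P \<or> b \<in> P"
  using assms[THEN subsetD[OF Hom_subset]] I_prime[of a b] I_r_closed[of a b] I_l_closed[of b a]
  by auto

end

lemma openin_zariski_subset: "openin (zariski d) V \<Longrightarrow> V \<subseteq> Proj d"
  using openin_subset[of "zariski d" V] by (auto simp: zariski_def basic_open_def)

lemma openin_basic_open: "f \<in> Hom d n \<Longrightarrow> openin (zariski d) (basic_open d f)"
  unfolding zariski_def by (rule topology_generated_by_Basis) auto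

text \<open>
  The constant regular functions on \<open>U\<close>: elements of the fraction field that have one global
  presentation over \<open>U\<close>. The condition \<open>b \<noteq> 0\<close> matters only for empty \<open>U\<close>, where a fraction with
  denominator zero would spoil closure under addition.
\<close>

definition fraction_on :: "nat \<Rightarrow> 'f::field pt set \<Rightarrow> 'f ratf \<Rightarrow> bool" where
  "fraction_on d U f \<longleftrightarrow>
     (\<exists>n a b. a \<in> Hom d n \<and> b \<in> Hom d n \<and> b \<noteq> 0 \<and> (\<forall>Q\<in>U. b \<notin> Q) \<and> f = Fraction_Field.Fract a b)"

lemma fraction_onI:
  "a \<in> Hom d n \<Longrightarrow> b \<in> Hom d n \<Longrightarrow> b \<noteq> 0 \<Longrightarrow> (\<And>Q. Q \<in> U \<Longrightarrow> b \<notin> Q) \<Longrightarrow>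
    fraction_on d U (Fraction_Field.Fract a b)"
  unfolding fraction_on_def by blast

lemma fraction_on_mono: "fraction_on d U f \<Longrightarrow> U' \<subseteq> U \<Longrightarrow> fraction_on d U' f"
  unfolding fraction_on_def by blast

lemma fraction_on_cst: "U \<subseteq> Proj d \<Longrightarrow> fraction_on d U (cst c)"
  unfolding cst_def by (rule fraction_onI[of _ _ 0]) (auto simp: Hom_const Hom_one Proj_one)

lemma fraction_on_add:
  assumes "U \<subseteq> Proj d" and "fraction_on d U f" and "fraction_on d U g"
  shows "fraction_on d U (f + g)"
proof -
  obtain n a b where f: "a \<in> Hom d n" "b \<in> Hom d n" "b \<noteq> 0" "\<forall>Q\<in>U. b \<notin> Q"
    "f = Fraction_Field.Fract a b"
    using assms(2) unfolding fraction_on_def by blast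
  obtain n' a' b' where g: "a' \<in> Hom d n'" "b' \<in> Hom d n'" "b' \<noteq> 0" "\<forall>Q\<in>U. b' \<notin> Q"
    "g = Fraction_Field.Fract a' b'"
    using assms(3) unfolding fraction_on_def by blast
  have "a * b' + a' * b \<in> Hom d (n + n')"
    using f g Hom_mult[of a d n b' n'] Hom_mult[of a' d n' b n] by (simp add: Hom_add add.commute)
  moreover have "b * b' \<notin> Q" if "Q \<in> U" for Q
    using Proj_mult_iff[of Q d b n b' n'] that assms(1) f g by auto
  ultimately show ?thesis
    using f g by (auto intro!: fraction_onI[of _ _ "n + n'"] Hom_mult)
qed

lemma fraction_on_mult:
  assumes "U \<subseteq> Proj d" and "fraction_on d U f" and "fraction_on d U g"
  shows "fraction_on d U (f * g)"
proof -
  obtain n a b where f: "a \<in> Hom d n" "b \<in> Hom d n" "b \<noteq> 0" "\<forall>Q\<in>U. b \<notin> Q"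
    "f = Fraction_Field.Fract a b"
    using assms(2) unfolding fraction_on_def by blast
  obtain n' a' b' where g: "a' \<in> Hom d n'" "b' \<in> Hom d n'" "b' \<noteq> 0" "\<forall>Q\<in>U. b' \<notin> Q"
    "g = Fraction_Field.Fract a' b'"
    using assms(3) unfolding fraction_on_def by blast
  have "b * b' \<notin> Q" if "Q \<in> U" for Q
    using Proj_mult_iff[of Q d b n b' n'] that assms(1) f g by auto
  then show ?thesis
    using f g by (auto intro!: fraction_onI[of _ _ "n + n'"] Hom_mult)
qed

lemma cst_hom: "comm_ring_hom cst"
proof
  show "cst 0 = 0" "cst 1 = 1"
    by (simp_all add: cst_def Zero_fract_def One_fract_def)
  show "cst (a + b) = cst a + cst b" "cst (a * b) = cst a * cst b" for a b :: 'a
    by (simp_all add: cst_def single_add mult_single)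
qed

lemma fraction_on_zero: "U \<subseteq> Proj d \<Longrightarrow> fraction_on d U 0"
  using fraction_on_cst[of U d 0] by (simp add: cst_def Zero_fract_def)

lemma fraction_on_sum:
  "U \<subseteq> Proj d \<Longrightarrow> (\<And>x. x \<in> I \<Longrightarrow> fraction_on d U (f x)) \<Longrightarrow> fraction_on d U (\<Sum>x\<in>I. f x)"
  by (induction I rule: infinite_finite_induct) (auto simp: fraction_on_zero fraction_on_add)

text \<open>
  Vanishing at \<open>P\<close> does not depend on the presentation: two presentations differ by cross
  multiplication, and \<open>P\<close> is prime.
\<close>

lemma Fract_in_stalk_max_ideal_iff:
  assumes "P \<in> Proj d" and "a \<in> Hom d n" and "b \<in> Hom d n" and "b \<notin> P"
  shows "Fraction_Field.Fract a b \<in> stalk_max_ideal d P \<longleftrightarrow> a \<in> P"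
proof
  assume "Fraction_Field.Fract a b \<in> stalk_max_ideal d P"
  then obtain a' b' n' where f: "a' \<in> Hom d n'" "b' \<in> Hom d n'" "a' \<in> P" "b' \<notin> P"
    "Fraction_Field.Fract a b = Fraction_Field.Fract a' b'"
    by (auto simp: stalk_max_ideal_def)
  have "b \<noteq> 0" "b' \<noteq> 0"
    using assms f Proj_zero by auto
  then have "a * b' = a' * b"
    using f(5) by (simp add: eq_fract)
  moreover have "a' * b \<in> P"
    using Proj_mult_iff[OF assms(1) f(1) assms(3)] f(3) by simp
  ultimately show "a \<in> P"
    using Proj_mult_iff[OF assms(1,2) f(2)] f(4) by simp
next
  assume "a \<in> P"
  then show "Fraction_Field.Fract a b \<in> stalk_max_ideal d P"
    using assms unfolding stalk_max_ideal_def mem_Collect_eq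
    by - (rule exI[of _ a], rule exI[of _ b], rule exI[of _ n], blast)
qed

lemma openin_nonvanishing:
  assumes "openin (zariski d) U" and "fraction_on d U f"
  shows "openin (zariski d) {P \<in> U. f \<notin> stalk_max_ideal d P}"
proof -
  obtain n a b where f: "a \<in> Hom d n" "b \<in> Hom d n" "b \<noteq> 0" "\<forall>Q\<in>U. b \<notin> Q"
    "f = Fraction_Field.Fract a b"
    using assms(2) unfolding fraction_on_def by blast
  have "f \<in> stalk_max_ideal d P \<longleftrightarrow> a \<in> P" if "P \<in> U" for P
    unfolding f(5) using openin_zariski_subset[OF assms(1)] f(1,2,4) that
    by (intro Fract_in_stalk_max_ideal_iff) auto
  then have "{P \<in> U. f \<notin> stalk_max_ideal d P} = U \<inter> basic_open d a"
    using openin_zariski_subset[OF assms(1)] by (auto simp: basic_open_def)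
  then show ?thesis
    using assms(1) openin_basic_open[OF f(1)] by (simp add: openin_Int)
qed

text \<open>
  A fraction that vanishes nowhere has a numerator outside every point, so numerator and
  denominator may be exchanged. For the norm of the deletion element this makes the inverse
  matrices regular.
\<close>

lemma fraction_on_inverse:
  assumes "U \<subseteq> Proj d" and "fraction_on d U f" and "f \<noteq> 0"
    and "\<And>P. P \<in> U \<Longrightarrow> f \<notin> stalk_max_ideal d P"
  shows "fraction_on d U (inverse f)"
proof -
  obtain n a b where f: "a \<in> Hom d n" "b \<in> Hom d n" "b \<noteq> 0" "\<forall>Q\<in>U. b \<notin> Q"
    "f = Fraction_Field.Fract a b"
    using assms(2) unfolding fraction_on_def by blast
  have "a \<noteq> 0"
    using f(5) assms(3) by (auto simp: fract_collapse)
  moreover have "a \<notin> P" if "P \<in> U" for P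
    using assms(1,4) that f Fract_in_stalk_max_ideal_iff[of P d a n b] by auto
  ultimately show ?thesis
    using f by (auto intro!: fraction_onI)
qed

lemma sections_off: "s \<in> sections d V \<Longrightarrow> P \<notin> V \<Longrightarrow> s P = 0"
  by (simp add: sections_def)

lemma sectionsE:
  assumes s: "s \<in> sections d V" and "P \<in> V"
  obtains U f where "openin (zariski d) U" "P \<in> U" "U \<subseteq> V" "fraction_on d U f" "\<forall>Q\<in>U. s Q = f"
proof -
  have "\<exists>U a b n. openin (zariski d) U \<and> P \<in> U \<and> U \<subseteq> V \<and> a \<in> Hom d n \<and> b \<in> Hom d n \<and>
      (\<forall>Q\<in>U. b \<notin> Q \<and> s Q = Fraction_Field.Fract a b)"
    using \<open>P \<in> V\<close> by (rule bspec[OF conjunct2[OF s[unfolded sections_def mem_Collect_eq]]])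
  then obtain U a b n where U: "openin (zariski d) U" "P \<in> U" "U \<subseteq> V" "a \<in> Hom d n" "b \<in> Hom d n"
    "\<forall>Q\<in>U. b \<notin> Q \<and> s Q = Fraction_Field.Fract a b"
    by (elim exE conjE)
  have "P \<in> Proj d"
    using openin_zariski_subset[OF U(1)] U(2) by (rule subsetD)
  then have "b \<noteq> 0"
    using Proj_zero[of P d] U(2,6) by blast
  then have "fraction_on d U (Fraction_Field.Fract a b)"
    using U(6) by (intro fraction_onI[OF U(4,5)]) auto
  then show ?thesis
    using U(6) by (intro that[OF U(1-3)]) auto
qed

lemma sectionsI:
  assumes off: "\<And>P. P \<notin> V \<Longrightarrow> s P = 0"
    and loc: "\<And>P. P \<in> V \<Longrightarrow> \<exists>U f. openin (zariski d) U \<and> P \<in> U \<and> U \<subseteq> V \<and>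
      fraction_on d U f \<and> (\<forall>Q\<in>U. s Q = f)"
  shows "s \<in> sections d V"
  unfolding sections_def mem_Collect_eq
proof (intro conjI allI impI ballI off)
  fix P assume "P \<in> V"
  then obtain U f where U: "openin (zariski d) U" "P \<in> U" "U \<subseteq> V" "fraction_on d U f" "\<forall>Q\<in>U. s Q = f"
    using loc by metis
  from U(4) obtain n a b where f: "a \<in> Hom d n" "b \<in> Hom d n" "\<forall>Q\<in>U. b \<notin> Q"
    "f = Fraction_Field.Fract a b"
    unfolding fraction_on_def by blast
  have "\<forall>Q\<in>U. b \<notin> Q \<and> s Q = Fraction_Field.Fract a b"
    using U(5) f(3,4) by simp
  with U(1-3) f(1,2) show "\<exists>U a b n. openin (zariski d) U \<and> P \<in> U \<and> U \<subseteq> V \<and>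
      a \<in> Hom d n \<and> b \<in> Hom d n \<and> (\<forall>Q\<in>U. b \<notin> Q \<and> s Q = Fraction_Field.Fract a b)"
    by - (rule exI[of _ U], rule exI[of _ a], rule exI[of _ b], rule exI[of _ n], blast)
qed

text \<open>
  Being a section is a local property. All gluing of sections goes through this lemma: the glued
  function is defined pointwise, and it agrees near every point with a given section.
\<close>

lemma sections_local:
  assumes off: "\<And>P. P \<notin> V \<Longrightarrow> s P = 0"
    and loc: "\<And>P. P \<in> V \<Longrightarrow> \<exists>U t. P \<in> U \<and> U \<subseteq> V \<and> t \<in> sections d U \<and> (\<forall>Q\<in>U. s Q = t Q)"
  shows "s \<in> sections d V"
proof (rule sectionsI)
  fix P assume "P \<in> V"
  then obtain U t where U: "P \<in> U" "U \<subseteq> V" "t \<in> sections d U" "\<forall>Q\<in>U. s Q = t Q"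
    using loc by metis
  obtain U' f where U': "openin (zariski d) U'" "P \<in> U'" "U' \<subseteq> U" "fraction_on d U' f"
    "\<forall>Q\<in>U'. t Q = f"
    by (rule sectionsE[OF U(3,1)])
  have "\<forall>Q\<in>U'. s Q = f"
    using U(4) U'(3,5) by (simp add: subset_iff)
  moreover have "U' \<subseteq> V"
    using U(2) U'(3) by blast
  ultimately show "\<exists>U f. openin (zariski d) U \<and> P \<in> U \<and> U \<subseteq> V \<and> fraction_on d U f \<and> (\<forall>Q\<in>U. s Q = f)"
    using U'(1,2,4) by (intro exI[of _ U'] exI[of _ f] conjI)
qed (rule off)

lemma sections_fraction:
  assumes "openin (zariski d) V" and "fraction_on d V f"
  shows "restrict_sec V (\<lambda>_. f) \<in> sections d V"
proof (rule sectionsI)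
  fix P assume "P \<in> V"
  then show "\<exists>U f'. openin (zariski d) U \<and> P \<in> U \<and> U \<subseteq> V \<and> fraction_on d U f' \<and>
      (\<forall>Q\<in>U. restrict_sec V (\<lambda>_. f) Q = f')"
    using assms by (intro exI[of _ V] exI[of _ f] conjI) (auto simp: restrict_sec_def)
qed (simp add: restrict_sec_def)

lemma sections_restrict:
  assumes s: "s \<in> sections d V" and V': "openin (zariski d) V'"
  shows "restrict_sec V' s \<in> sections d (V \<inter> V')"
proof (rule sectionsI)
  fix P assume P: "P \<in> V \<inter> V'"
  obtain U f where U: "openin (zariski d) U" "P \<in> U" "U \<subseteq> V" "fraction_on d U f"
    "\<forall>Q\<in>U. s Q = f"
    by (rule sectionsE[OF s]) (use P in auto)
  show "\<exists>U f. openin (zariski d) U \<and> P \<in> U \<and> U \<subseteq> V \<inter> V' \<and> fraction_on d U f \<and>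
      (\<forall>Q\<in>U. restrict_sec V' s Q = f)"
  proof (intro exI[of _ "U \<inter> V'"] exI[of _ f] conjI)
    show "fraction_on d (U \<inter> V') f"
      using U(4) by (rule fraction_on_mono) simp
  qed (use U(1-3,5) P V' in \<open>auto simp: restrict_sec_def openin_Int\<close>)
qed (use s in \<open>auto simp: restrict_sec_def sections_off\<close>)

lemma sections_common_neighbourhood:
  assumes s: "s \<in> sections d V" and t: "t \<in> sections d V'" and P: "P \<in> V" "P \<in> V'"
  obtains U f f' where "openin (zariski d) U" "P \<in> U" "U \<subseteq> V \<inter> V'" "fraction_on d U f"
    "fraction_on d U f'" "\<forall>Q\<in>U. s Q = f" "\<forall>Q\<in>U. t Q = f'"
proof -
  obtain U f where U: "openin (zariski d) U" "P \<in> U" "U \<subseteq> V" "fraction_on d U f"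
    "\<forall>Q\<in>U. s Q = f"
    by (rule sectionsE[OF s P(1)])
  obtain U' f' where U': "openin (zariski d) U'" "P \<in> U'" "U' \<subseteq> V'" "fraction_on d U' f'"
    "\<forall>Q\<in>U'. t Q = f'"
    by (rule sectionsE[OF t P(2)])
  show ?thesis
  proof (rule that[of "U \<inter> U'" f f'])
    show "fraction_on d (U \<inter> U') f" "fraction_on d (U \<inter> U') f'"
      by (rule fraction_on_mono[OF U(4)], simp) (rule fraction_on_mono[OF U'(4)], simp)
  qed (use U(1-3,5) U'(1-3,5) in \<open>auto simp: openin_Int\<close>)
qed

lemma sections_mult:
  assumes "s \<in> sections d V" and "t \<in> sections d V'"
  shows "s * t \<in> sections d (V \<inter> V')"
proof (rule sectionsI)
  fix P assume P: "P \<in> V \<inter> V'"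
  obtain U f f' where U: "openin (zariski d) U" "P \<in> U" "U \<subseteq> V \<inter> V'" "fraction_on d U f"
    "fraction_on d U f'" "\<forall>Q\<in>U. s Q = f" "\<forall>Q\<in>U. t Q = f'"
    by (rule sections_common_neighbourhood[OF assms]) (use P in auto)
  have "fraction_on d U (f * f')"
    using openin_zariski_subset[OF U(1)] U(4,5) by (rule fraction_on_mult)
  then show "\<exists>U f. openin (zariski d) U \<and> P \<in> U \<and> U \<subseteq> V \<inter> V' \<and> fraction_on d U f \<and>
      (\<forall>Q\<in>U. (s * t) Q = f)"
    using U(1-3,6,7) by (intro exI[of _ U] exI[of _ "f * f'"] conjI) auto
qed (use assms in \<open>auto simp: sections_off\<close>)

lemma sections_add:
  assumes "s \<in> sections d V" and "t \<in> sections d V"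
  shows "s + t \<in> sections d V"
proof (rule sectionsI)
  fix P assume P: "P \<in> V"
  obtain U f f' where U: "openin (zariski d) U" "P \<in> U" "U \<subseteq> V \<inter> V" "fraction_on d U f"
    "fraction_on d U f'" "\<forall>Q\<in>U. s Q = f" "\<forall>Q\<in>U. t Q = f'"
    by (rule sections_common_neighbourhood[OF assms P P])
  have "fraction_on d U (f + f')"
    using openin_zariski_subset[OF U(1)] U(4,5) by (rule fraction_on_add)
  then show "\<exists>U f. openin (zariski d) U \<and> P \<in> U \<and> U \<subseteq> V \<and> fraction_on d U f \<and>
      (\<forall>Q\<in>U. (s + t) Q = f)"
    using U(1-3,6,7) by (intro exI[of _ U] exI[of _ "f + f'"] conjI) auto
qed (use assms in \<open>auto simp: sections_off\<close>)

lemma sections_zero: "openin (zariski d) V \<Longrightarrow> 0 \<in> sections d V"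
  using sections_fraction[OF _ fraction_on_zero, of d V] openin_zariski_subset[of d V]
  by (simp add: restrict_sec_def zero_fun_def)

lemma sections_one: "openin (zariski d) V \<Longrightarrow> restrict_sec V 1 \<in> sections d V"
  using sections_fraction[OF _ fraction_on_cst, of d V 1] openin_zariski_subset[of d V]
  by (simp add: restrict_sec_def one_fun_def cst_def One_fract_def[symmetric])

lemma sections_sum:
  "openin (zariski d) V \<Longrightarrow> (\<And>x. x \<in> I \<Longrightarrow> s x \<in> sections d V) \<Longrightarrow> (\<Sum>x\<in>I. s x) \<in> sections d V"
  by (induction I rule: infinite_finite_induct) (auto simp: sections_zero sections_add)

text \<open>
  Negation is multiplication by the constant section \<open>-1\<close>.
\<close>

lemma sections_uminus:
  assumes V: "openin (zariski d) V" and s: "s \<in> sections d V"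
  shows "- s \<in> sections d V"
proof -
  have "restrict_sec V (\<lambda>_. cst (- 1)) * s \<in> sections d (V \<inter> V)"
    using V s openin_zariski_subset[OF V] by (intro sections_mult sections_fraction fraction_on_cst)
  moreover have "restrict_sec V (\<lambda>_. cst (- 1)) * s = - s"
  proof -
    interpret comm_ring_hom cst by (rule cst_hom)
    show ?thesis
      using s by (auto simp: fun_eq_iff restrict_sec_def sections_off hom_uminus)
  qed
  ultimately show ?thesis
    by simp
qed

lemma struct_sheaf_cring:
  assumes V: "openin (zariski d) V"
  shows "cring (struct_sheaf d V)"
proof (rule cringI)
  show "abelian_group (struct_sheaf d V)"
  proof (rule abelian_groupI)
    fix s assume "s \<in> carrier (struct_sheaf d V)"
    then show "\<exists>t\<in>carrier (struct_sheaf d V). t \<oplus>\<^bsub>struct_sheaf d V\<^esub> s = \<zero>\<^bsub>struct_sheaf d V\<^esub>"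
      using V by (intro bexI[of _ "- s"]) (auto simp: struct_sheaf_def sections_uminus)
  qed (use V in \<open>auto simp: struct_sheaf_def sections_add sections_zero ac_simps\<close>)
  have one: "restrict_sec V 1 * s = s" if "s \<in> sections d V" for s
    using that by (auto simp: fun_eq_iff restrict_sec_def sections_off)
  show "comm_monoid (struct_sheaf d V)"
  proof (rule comm_monoidI)
    show "\<one>\<^bsub>struct_sheaf d V\<^esub> \<otimes>\<^bsub>struct_sheaf d V\<^esub> s = s" if "s \<in> carrier (struct_sheaf d V)" for s
      using that one by (simp add: struct_sheaf_def)
    show "s \<otimes>\<^bsub>struct_sheaf d V\<^esub> t \<in> carrier (struct_sheaf d V)"
      if "s \<in> carrier (struct_sheaf d V)" "t \<in> carrier (struct_sheaf d V)" for s t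
      using that sections_mult[of s d V t V] by (simp add: struct_sheaf_def)
  qed (use V in \<open>simp_all add: struct_sheaf_def sections_one mult.assoc mult.commute\<close>)
qed (simp add: struct_sheaf_def distrib_right)

section \<open>Vectors and matrices of sections\<close>

text \<open>
  Sections are functions on points with values in one fraction field, so identities between vectors
  and matrices of sections can be checked on their values, by linear algebra over that field.
\<close>

definition vec_at :: "'f::field pt \<Rightarrow> 'f regf vec \<Rightarrow> 'f ratf vec" where
  "vec_at P = map_vec (\<lambda>f. f P)"

definition mat_at :: "'f::field pt \<Rightarrow> 'f regf mat \<Rightarrow> 'f ratf mat" where
  "mat_at P = map_mat (\<lambda>f. f P)"

lemma smult_zero_right: "(c :: 'a::mult_zero) \<cdot>\<^sub>v 0\<^sub>v r = 0\<^sub>v r"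
  by (intro eq_vecI) auto

lemma evaluation_hom: "semiring_hom (\<lambda>f :: 'f::field regf. f P)"
  by standard auto

lemma dim_vec_at [simp]: "dim_vec (vec_at P v) = dim_vec v"
  by (simp add: vec_at_def)

lemma vec_at_carrier [simp]: "vec_at P v \<in> carrier_vec r \<longleftrightarrow> v \<in> carrier_vec r"
  by (simp add: vec_at_def)

lemma mat_at_carrier [simp]: "mat_at P A \<in> carrier_mat m n \<longleftrightarrow> A \<in> carrier_mat m n"
  by (simp add: mat_at_def)

lemma vec_at_index [simp]: "k < dim_vec v \<Longrightarrow> vec_at P v $ k = (v $ k) P"
  by (simp add: vec_at_def)

lemma vec_at_zero [simp]: "vec_at P (0\<^sub>v r) = 0\<^sub>v r"
  by (intro eq_vecI) auto

lemma vec_at_add: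
  "v \<in> carrier_vec r \<Longrightarrow> w \<in> carrier_vec r \<Longrightarrow> vec_at P (v + w) = vec_at P v + vec_at P w"
  by (intro eq_vecI) (auto simp: vec_at_def)

lemma vec_at_smult: "vec_at P (a \<cdot>\<^sub>v v) = a P \<cdot>\<^sub>v vec_at P v"
  by (intro eq_vecI) (auto simp: vec_at_def)

lemma vec_at_mult:
  assumes "A \<in> carrier_mat m n" and "v \<in> carrier_vec n"
  shows "vec_at P (A *\<^sub>v v) = mat_at P A *\<^sub>v vec_at P v"
  unfolding vec_at_def mat_at_def
  by (rule semiring_hom.mult_mat_vec_hom[OF evaluation_hom[of P] assms])

lemma mat_at_mult:
  assumes "A \<in> carrier_mat m n" and "B \<in> carrier_mat n l"
  shows "mat_at P (A * B) = mat_at P A * mat_at P B"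
  unfolding mat_at_def by (rule semiring_hom.mat_hom_mult[OF evaluation_hom[of P] assms])

lemma vec_at_restrict:
  "v \<in> carrier_vec r \<Longrightarrow> vec_at P (restrict_vec V v) = (if P \<in> V then vec_at P v else 0\<^sub>v r)"
  by (intro eq_vecI) (auto simp: vec_at_def restrict_vec_def restrict_sec_def)

lemma mat_at_restrict: "P \<in> V \<Longrightarrow> mat_at P (restrict_mat V A) = mat_at P A"
  by (intro eq_matI) (auto simp: mat_at_def restrict_mat_def restrict_sec_def)

lemma mat_at_section: "P \<in> V \<Longrightarrow> mat_at P (section_mat V A) = A"
  by (intro eq_matI) (auto simp: mat_at_def section_mat_def restrict_sec_def)

lemma mat_at_one [simp]: "mat_at P (1\<^sub>m r) = 1\<^sub>m r"
  by (intro eq_matI) (auto simp: mat_at_def)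

lemma restrict_vec_carrier [simp]: "restrict_vec V v \<in> carrier_vec r \<longleftrightarrow> v \<in> carrier_vec r"
  by (simp add: restrict_vec_def)

lemma vec_eq_pointwise:
  assumes "v \<in> carrier_vec r" and "w \<in> carrier_vec r" and "\<And>P. vec_at P v = vec_at P w"
  shows "v = w"
proof (rule eq_vecI)
  fix k assume k: "k < dim_vec w"
  show "v $ k = w $ k"
  proof
    fix P
    have "(v $ k) P = vec_at P v $ k" "(w $ k) P = vec_at P w $ k"
      using k assms(1,2) by auto
    then show "(v $ k) P = (w $ k) P"
      by (simp only: assms(3)[of P])
  qed
qed (use assms in auto)

lemma restrict_vec_eq_iff:
  assumes "v \<in> carrier_vec r" and "w \<in> carrier_vec r"
  shows "restrict_vec V v = restrict_vec V w \<longleftrightarrow> (\<forall>P\<in>V. vec_at P v = vec_at P w)"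
proof
  assume "restrict_vec V v = restrict_vec V w"
  then show "\<forall>P\<in>V. vec_at P v = vec_at P w"
    using assms vec_at_restrict by metis
next
  assume "\<forall>P\<in>V. vec_at P v = vec_at P w"
  then show "restrict_vec V v = restrict_vec V w"
    using assms by (intro vec_eq_pointwise[of _ r]) (auto simp: vec_at_restrict[of _ r])
qed

definition section_vecs :: "nat \<Rightarrow> 'f::field pt set \<Rightarrow> nat \<Rightarrow> 'f regf vec set" where
  "section_vecs d V r = {v \<in> carrier_vec r. \<forall>k<r. v $ k \<in> sections d V}"

lemma section_vecs_carrier: "v \<in> section_vecs d V r \<Longrightarrow> v \<in> carrier_vec r"
  by (simp add: section_vecs_def)

lemma section_vecs_off: "v \<in> section_vecs d V r \<Longrightarrow> P \<notin> V \<Longrightarrow> vec_at P v = 0\<^sub>v r"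
  by (intro eq_vecI) (auto simp: section_vecs_def sections_off)

lemma section_vecs_eqI:
  assumes "v \<in> section_vecs d V r" and "w \<in> section_vecs d V r"
    and "\<And>P. P \<in> V \<Longrightarrow> vec_at P v = vec_at P w"
  shows "v = w"
proof (rule vec_eq_pointwise)
  show "vec_at P v = vec_at P w" for P
  proof (cases "P \<in> V")
    case False
    show ?thesis
      by (simp only: section_vecs_off[OF assms(1) False] section_vecs_off[OF assms(2) False])
  qed (rule assms(3))
next
  show "v \<in> carrier_vec r" "w \<in> carrier_vec r"
    using assms(1,2)[THEN section_vecs_carrier] by this+
qed

lemma section_vecs_zero: "openin (zariski d) V \<Longrightarrow> 0\<^sub>v r \<in> section_vecs d V r"
  by (auto simp: section_vecs_def sections_zero)

lemma section_vecs_add: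
  "v \<in> section_vecs d V r \<Longrightarrow> w \<in> section_vecs d V r \<Longrightarrow> v + w \<in> section_vecs d V r"
  by (auto simp: section_vecs_def sections_add)

lemma section_vecs_smult:
  "a \<in> sections d V \<Longrightarrow> v \<in> section_vecs d V' r \<Longrightarrow> a \<cdot>\<^sub>v v \<in> section_vecs d (V \<inter> V') r"
  by (auto simp: section_vecs_def sections_mult)

lemma section_vecs_one:
  assumes v: "v \<in> section_vecs d V' r" and "V' \<subseteq> V"
  shows "restrict_sec V 1 \<cdot>\<^sub>v v = v"
proof (rule eq_vecI)
  fix k assume k: "k < dim_vec v"
  have "(restrict_sec V 1 * v $ k) P = (v $ k) P" for P
  proof (cases "P \<in> V'")
    case True
    then show ?thesis
      using \<open>V' \<subseteq> V\<close> by (auto simp: restrict_sec_def)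
  next
    case False
    have "v $ k \<in> sections d V'"
      using v k by (auto simp: section_vecs_def)
    then have "(v $ k) P = 0"
      using False by (rule sections_off)
    then show ?thesis
      by simp
  qed
  then show "(restrict_sec V 1 \<cdot>\<^sub>v v) $ k = v $ k"
    using k by (auto simp: fun_eq_iff)
qed simp

lemma section_vecs_uminus:
  assumes v: "v \<in> section_vecs d V' r" and "V' \<subseteq> V"
  shows "(- restrict_sec V 1) \<cdot>\<^sub>v v + v = 0\<^sub>v r"
proof (rule eq_vecI)
  fix k assume k: "k < dim_vec (0\<^sub>v r :: 'a regf vec)"
  have "(- restrict_sec V 1 * v $ k + v $ k) P = 0" for P
  proof (cases "P \<in> V'")
    case True
    then show ?thesis
      using \<open>V' \<subseteq> V\<close> by (auto simp: restrict_sec_def)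
  next
    case False
    have "v $ k \<in> sections d V'"
      using v k by (auto simp: section_vecs_def)
    then have "(v $ k) P = 0"
      using False by (rule sections_off)
    then show ?thesis
      by simp
  qed
  then show "((- restrict_sec V 1) \<cdot>\<^sub>v v + v) $ k = 0\<^sub>v r $ k"
    using k section_vecs_carrier[OF v] by (auto simp: fun_eq_iff)
qed (use section_vecs_carrier[OF v] in auto)

lemma section_vecs_restrict:
  "v \<in> section_vecs d V r \<Longrightarrow> openin (zariski d) V' \<Longrightarrow> restrict_vec V' v \<in> section_vecs d (V \<inter> V') r"
  by (auto simp: section_vecs_def restrict_vec_def sections_restrict)

lemma section_vecs_mult:
  assumes "A \<in> sections_mat d V r" and "v \<in> section_vecs d V' r"
    and "openin (zariski d) (V \<inter> V')"
  shows "A *\<^sub>v v \<in> section_vecs d (V \<inter> V') r"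
proof -
  have "(A *\<^sub>v v) $ k \<in> sections d (V \<inter> V')" if "k < r" for k
  proof -
    have "(A *\<^sub>v v) $ k = (\<Sum>l<r. A $$ (k, l) * v $ l)"
      using assms that
      by (auto simp: sections_mat_def section_vecs_def scalar_prod_def atLeast0LessThan intro!: sum.cong)
    then show ?thesis
      using assms that by (auto simp: sections_mat_def section_vecs_def intro!: sections_sum sections_mult)
  qed
  moreover have "A *\<^sub>v v \<in> carrier_vec r"
    using assms(1,2) by (intro mult_mat_vec_carrier[of _ r r]) (auto simp: sections_mat_def section_vecs_def)
  ultimately show ?thesis
    by (simp add: section_vecs_def)
qed

lemma section_vecs_local:
  assumes "v \<in> carrier_vec r" and "\<And>P. P \<notin> V \<Longrightarrow> vec_at P v = 0\<^sub>v r"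
    and "\<And>P. P \<in> V \<Longrightarrow> \<exists>U w. P \<in> U \<and> U \<subseteq> V \<and> w \<in> section_vecs d U r \<and>
      (\<forall>Q\<in>U. vec_at Q v = vec_at Q w)"
  shows "v \<in> section_vecs d V r"
proof -
  have "v $ k \<in> sections d V" if k: "k < r" for k
  proof (rule sections_local)
    fix P assume "P \<notin> V"
    then show "(v $ k) P = 0"
      using assms(1) assms(2)[of P] k vec_at_index[of k v P] by simp
  next
    fix P assume P: "P \<in> V"
    obtain U w where U: "P \<in> U" "U \<subseteq> V" "w \<in> section_vecs d U r" "\<forall>Q\<in>U. vec_at Q v = vec_at Q w"
      using assms(3)[OF P] by (elim exE conjE)
    have eq: "(v $ k) Q = (w $ k) Q" if "Q \<in> U" for Q
    proof -
      have "(v $ k) Q = vec_at Q v $ k" "(w $ k) Q = vec_at Q w $ k"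
        using assms(1) section_vecs_carrier[OF U(3)] k by auto
      then show ?thesis
        using bspec[OF U(4) that] by simp
    qed
    have "w $ k \<in> sections d U"
      using U(3) k by (simp add: section_vecs_def)
    with U(1,2) eq show "\<exists>U t. P \<in> U \<and> U \<subseteq> V \<and> t \<in> sections d U \<and> (\<forall>Q\<in>U. (v $ k) Q = t Q)"
      by (intro exI[of _ U] exI[of _ "w $ k"] conjI ballI)
  qed
  then show ?thesis
    using assms(1) by (simp add: section_vecs_def)
qed

lemma mat_eq_pointwise:
  assumes "A \<in> carrier_mat m n" and "B \<in> carrier_mat m n" and eq: "\<And>P. mat_at P A = mat_at P B"
  shows "A = B"
proof (rule eq_matI)
  fix k l assume kl: "k < dim_row B" "l < dim_col B"
  show "A $$ (k, l) = B $$ (k, l)"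
  proof
    fix P
    have "(A $$ (k, l)) P = mat_at P A $$ (k, l)" "(B $$ (k, l)) P = mat_at P B $$ (k, l)"
      using kl assms(1,2) by (auto simp: mat_at_def)
    then show "(A $$ (k, l)) P = (B $$ (k, l)) P"
      by (simp only: eq[of P])
  qed
qed (use assms(1,2) in auto)

lemma mat_at_restrict_off:
  "A \<in> carrier_mat m n \<Longrightarrow> P \<notin> V \<Longrightarrow> mat_at P (restrict_mat V A) = 0\<^sub>m m n"
  by (intro eq_matI) (auto simp: mat_at_def restrict_mat_def restrict_sec_def)

lemma mat_at_section_off:
  "A \<in> carrier_mat m n \<Longrightarrow> P \<notin> V \<Longrightarrow> mat_at P (section_mat V A) = 0\<^sub>m m n"
  by (intro eq_matI) (auto simp: mat_at_def section_mat_def restrict_sec_def)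

lemma restrict_mat_carrier [simp]: "restrict_mat V A \<in> carrier_mat m n \<longleftrightarrow> A \<in> carrier_mat m n"
  by (simp add: restrict_mat_def)

lemma section_mat_carrier [simp]: "section_mat V A \<in> carrier_mat m n \<longleftrightarrow> A \<in> carrier_mat m n"
  by (simp add: section_mat_def)

lemma restrict_mat_eqI:
  assumes "A \<in> carrier_mat m n" and "B \<in> carrier_mat m n" and "\<And>P. P \<in> V \<Longrightarrow> mat_at P A = mat_at P B"
  shows "restrict_mat V A = restrict_mat V B"
proof (rule mat_eq_pointwise)
  fix P
  show "mat_at P (restrict_mat V A) = mat_at P (restrict_mat V B)"
  proof (cases "P \<in> V")
    case True
    then show ?thesis
      by (simp add: mat_at_restrict assms(3))
  next
    case False
    then show ?thesis
      using assms(1,2) by (simp add: mat_at_restrict_off)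
  qed
qed (use assms(1,2) in auto)

lemma section_mat_one: "section_mat V (1\<^sub>m r) = restrict_mat V (1\<^sub>m r)"
proof (rule mat_eq_pointwise[of _ r r])
  fix P :: "'a pt"
  show "mat_at P (section_mat V (1\<^sub>m r)) = mat_at P (restrict_mat V (1\<^sub>m r))"
    by (cases "P \<in> V") (simp_all add: mat_at_section mat_at_restrict
        mat_at_section_off[of _ r r] mat_at_restrict_off[of _ r r])
qed auto

lemma section_mat_mult:
  assumes A: "A \<in> carrier_mat m n" and B: "B \<in> carrier_mat n l"
  shows "section_mat V A * section_mat V B = section_mat V (A * B)"
proof (rule mat_eq_pointwise[of _ m l])
  fix P
  have eq: "mat_at P (section_mat V A * section_mat V B) =
      mat_at P (section_mat V A) * mat_at P (section_mat V B)"
    using A B by (intro mat_at_mult[of _ m n _ l]) auto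
  show "mat_at P (section_mat V A * section_mat V B) = mat_at P (section_mat V (A * B))"
  proof (cases "P \<in> V")
    case True
    then show ?thesis
      by (simp add: eq mat_at_section)
  next
    case False
    then show ?thesis
      unfolding eq using A B
      by (simp add: mat_at_section_off[of A m n] mat_at_section_off[of B n l]
          mat_at_section_off[of "A * B" m l])
  qed
qed (use A B in auto)

section \<open>Sheaves glued from matrices\<close>

lemma opens_in_iff: "V \<in> opens_in d X \<longleftrightarrow> openin (zariski d) V \<and> V \<subseteq> X"
  by (simp add: opens_in_def)

lemma free_module_simps [simp]:
  "carrier (sec (free_module d r) V) = section_vecs d V r"
  "add (sec (free_module d r) V) = (+)"
  "Module.smult (sec (free_module d r) V) = (\<cdot>\<^sub>v)"
  "res (free_module d r) V V' = restrict_vec V'"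
  by (simp_all add: free_module_def section_vecs_def)

lemma glued_bundle_simps [simp]:
  "zero (sec (glued_bundle d I W r g) V) = (\<lambda>i\<in>I. 0\<^sub>v r)"
  "add (sec (glued_bundle d I W r g) V) s t = (\<lambda>i\<in>I. s i + t i)"
  "Module.smult (sec (glued_bundle d I W r g) V) a s = (\<lambda>i\<in>I. a \<cdot>\<^sub>v s i)"
  "res (glued_bundle d I W r g) V V' s = (\<lambda>i\<in>I. restrict_vec V' (s i))"
  by (simp_all add: glued_bundle_def)

text \<open>
  Compatible families form a sheaf of modules for arbitrary matrices \<open>g i j\<close>, because the relations
  between the components are linear and can be checked at each point.
\<close>

locale gluing_data =
  fixes d :: nat and I :: "nat set" and W :: "nat \<Rightarrow> 'f::field pt set" and r :: nat
    and g :: "nat \<Rightarrow> nat \<Rightarrow> 'f regf mat"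
  assumes W_open: "i \<in> I \<Longrightarrow> openin (zariski d) (W i)"
    and g_carrier: "i \<in> I \<Longrightarrow> j \<in> I \<Longrightarrow> g i j \<in> carrier_mat r r"
begin

abbreviation "E \<equiv> glued_bundle d I W r g"

text \<open>
  The gluing condition becomes a linear relation between the values at each point.
\<close>

lemma glued_carrier_iff:
  "s \<in> carrier (sec E V) \<longleftrightarrow> s \<in> (\<Pi>\<^sub>E i\<in>I. section_vecs d (V \<inter> W i) r) \<and>
     (\<forall>i\<in>I. \<forall>j\<in>I. \<forall>P\<in>V \<inter> W i \<inter> W j. vec_at P (s i) = mat_at P (g i j) *\<^sub>v vec_at P (s j))"
  (is "_ \<longleftrightarrow> ?L \<and> ?R")
proof -
  have "(restrict_vec (V \<inter> W i \<inter> W j) (s i) = restrict_vec (V \<inter> W i \<inter> W j) (g i j *\<^sub>v s j)) \<longleftrightarrow>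
      (\<forall>P\<in>V \<inter> W i \<inter> W j. vec_at P (s i) = mat_at P (g i j) *\<^sub>v vec_at P (s j))"
    if s: ?L and ij: "i \<in> I" "j \<in> I" for i j
  proof -
    have "s i \<in> carrier_vec r" "s j \<in> carrier_vec r"
      using s ij by (auto simp: section_vecs_def)
    then show ?thesis
      using g_carrier[OF ij] by (subst restrict_vec_eq_iff[of _ r]) (auto simp: vec_at_mult[of _ r r])
  qed
  moreover have "s \<in> carrier (sec E V) \<longleftrightarrow> ?L \<and> (\<forall>i\<in>I. \<forall>j\<in>I.
      restrict_vec (V \<inter> W i \<inter> W j) (s i) = restrict_vec (V \<inter> W i \<inter> W j) (g i j *\<^sub>v s j))"
    by (simp add: glued_bundle_def[of d I W r g])
  ultimately show ?thesis
    by (auto simp only: ball_simps cong: conj_cong ball_cong)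
qed

lemma glued_components:
  "s \<in> carrier (sec E V) \<Longrightarrow> i \<in> I \<Longrightarrow> s i \<in> section_vecs d (V \<inter> W i) r"
  using glued_carrier_iff[of s V] by (blast dest: PiE_mem)

lemma glued_components_carrier:
  "s \<in> carrier (sec E V) \<Longrightarrow> i \<in> I \<Longrightarrow> s i \<in> carrier_vec r"
  by (rule section_vecs_carrier) (rule glued_components)

lemma glued_compatible:
  assumes s: "s \<in> carrier (sec E V)" and "i \<in> I" and "j \<in> I" and "P \<in> V" and "P \<in> W i" and "P \<in> W j"
  shows "vec_at P (s i) = mat_at P (g i j) *\<^sub>v vec_at P (s j)"
  using bspec[OF bspec[OF bspec[OF conjunct2[OF iffD1[OF glued_carrier_iff s]] assms(2)] assms(3)], of P]
    assms(4-6) by blast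

lemma glued_extensional:
  assumes s: "s \<in> carrier (sec E V)"
  shows "s \<in> extensional I"
  using conjunct1[OF iffD1[OF glued_carrier_iff s]] by (simp add: PiE_def)

lemma glued_eqI:
  assumes "s \<in> carrier (sec E V)" and "t \<in> carrier (sec E V)"
    and "\<And>i P. i \<in> I \<Longrightarrow> P \<in> V \<Longrightarrow> P \<in> W i \<Longrightarrow> vec_at P (s i) = vec_at P (t i)"
  shows "s = t"
proof (rule extensionalityI)
  show "s i = t i" if "i \<in> I" for i
    using that assms by (intro section_vecs_eqI[OF glued_components glued_components]) auto
qed (use assms(1,2)[THEN glued_extensional] in \<open>this+\<close>)

lemma glued_zero: "openin (zariski d) V \<Longrightarrow> (\<lambda>i\<in>I. 0\<^sub>v r) \<in> carrier (sec E V)"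
  unfolding glued_carrier_iff
proof (intro conjI ballI)
  fix i j P assume "i \<in> I" "j \<in> I"
  then show "vec_at P ((\<lambda>i\<in>I. 0\<^sub>v r) i) = mat_at P (g i j) *\<^sub>v vec_at P ((\<lambda>i\<in>I. 0\<^sub>v r) j)"
    using g_carrier[of i j] by (auto simp: mat_at_def intro!: eq_vecI)
qed (use W_open in \<open>auto intro!: section_vecs_zero openin_Int\<close>)

lemma glued_add:
  assumes "s \<in> carrier (sec E V)" and "t \<in> carrier (sec E V)"
  shows "(\<lambda>i\<in>I. s i + t i) \<in> carrier (sec E V)"
  unfolding glued_carrier_iff
proof (intro conjI ballI)
  fix i j P assume ij: "i \<in> I" "j \<in> I" and P: "P \<in> V \<inter> W i \<inter> W j"
  show "vec_at P ((\<lambda>i\<in>I. s i + t i) i) = mat_at P (g i j) *\<^sub>v vec_at P ((\<lambda>i\<in>I. s i + t i) j)"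
    using ij P assms g_carrier[OF ij]
    by (simp add: vec_at_add[of _ r] glued_components_carrier mult_add_distrib_mat_vec[of _ r r]
        glued_compatible[of _ _ i j])
next
  have "s i + t i \<in> section_vecs d (V \<inter> W i) r" if "i \<in> I" for i
    using assms[THEN glued_components, OF that] by (rule section_vecs_add)
  then show "(\<lambda>i\<in>I. s i + t i) \<in> (\<Pi>\<^sub>E i\<in>I. section_vecs d (V \<inter> W i) r)"
    by simp
qed

lemma glued_smult:
  assumes "a \<in> sections d V" and "s \<in> carrier (sec E V)"
  shows "(\<lambda>i\<in>I. a \<cdot>\<^sub>v s i) \<in> carrier (sec E V)"
  unfolding glued_carrier_iff
proof (intro conjI ballI)
  fix i j P assume ij: "i \<in> I" "j \<in> I" and P: "P \<in> V \<inter> W i \<inter> W j"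
  show "vec_at P ((\<lambda>i\<in>I. a \<cdot>\<^sub>v s i) i) = mat_at P (g i j) *\<^sub>v vec_at P ((\<lambda>i\<in>I. a \<cdot>\<^sub>v s i) j)"
    using ij P assms g_carrier[OF ij]
    by (simp add: vec_at_smult glued_components_carrier mult_mat_vec[of _ r r]
        glued_compatible[of _ _ i j])
next
  have "a \<cdot>\<^sub>v s i \<in> section_vecs d (V \<inter> W i) r" if "i \<in> I" for i
    using section_vecs_smult[OF assms(1) glued_components[OF assms(2) that]] by simp
  then show "(\<lambda>i\<in>I. a \<cdot>\<^sub>v s i) \<in> (\<Pi>\<^sub>E i\<in>I. section_vecs d (V \<inter> W i) r)"
    by simp
qed

lemma glued_restrict:
  assumes "s \<in> carrier (sec E V)" and "V' \<in> opens_in d V"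
  shows "(\<lambda>i\<in>I. restrict_vec V' (s i)) \<in> carrier (sec E V')"
  unfolding glued_carrier_iff
proof (intro conjI ballI)
  fix i j P assume ij: "i \<in> I" "j \<in> I" and P: "P \<in> V' \<inter> W i \<inter> W j"
  then have "P \<in> V"
    using assms(2) by (auto simp: opens_in_iff)
  then show "vec_at P ((\<lambda>i\<in>I. restrict_vec V' (s i)) i) =
      mat_at P (g i j) *\<^sub>v vec_at P ((\<lambda>i\<in>I. restrict_vec V' (s i)) j)"
    using ij P assms(1)
    by (simp add: vec_at_restrict[of _ r] glued_components_carrier glued_compatible[of _ _ i j])
next
  have "restrict_vec V' (s i) \<in> section_vecs d (V' \<inter> W i) r" if "i \<in> I" for i
  proof -
    have "V \<inter> W i \<inter> V' = V' \<inter> W i"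
      using assms(2) by (auto simp: opens_in_iff)
    then show ?thesis
      using section_vecs_restrict[OF glued_components[OF assms(1) that], of V'] assms(2)
      by (simp add: opens_in_iff)
  qed
  then show "(\<lambda>i\<in>I. restrict_vec V' (s i)) \<in> (\<Pi>\<^sub>E i\<in>I. section_vecs d (V' \<inter> W i) r)"
    by simp
qed

lemma glued_module:
  assumes V: "openin (zariski d) V"
  shows "Module.module (struct_sheaf d V) (sec E V)"
proof (rule moduleI)
  show "cring (struct_sheaf d V)"
    using V by (rule struct_sheaf_cring)
  show "abelian_group (sec E V)"
  proof (rule abelian_groupI)
    fix s assume s: "s \<in> carrier (sec E V)"
    let ?m = "\<lambda>i\<in>I. (- restrict_sec V 1) \<cdot>\<^sub>v s i"
    have m: "?m \<in> carrier (sec E V)"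
      using s V by (intro glued_smult sections_uminus sections_one)
    have "?m \<oplus>\<^bsub>sec E V\<^esub> s = \<zero>\<^bsub>sec E V\<^esub>"
      using section_vecs_uminus[OF glued_components[OF s], of _ V] by (auto intro!: restrict_ext)
    then show "\<exists>t\<in>carrier (sec E V). t \<oplus>\<^bsub>sec E V\<^esub> s = \<zero>\<^bsub>sec E V\<^esub>"
      using m by blast
  next
    fix s assume s: "s \<in> carrier (sec E V)"
    show "\<zero>\<^bsub>sec E V\<^esub> \<oplus>\<^bsub>sec E V\<^esub> s = s"
      using glued_extensional[OF s] glued_components_carrier[OF s]
      by (intro extensionalityI[of _ I]) auto
  next
    fix s t u assume "s \<in> carrier (sec E V)" "t \<in> carrier (sec E V)" "u \<in> carrier (sec E V)"
    then show "s \<oplus>\<^bsub>sec E V\<^esub> t \<oplus>\<^bsub>sec E V\<^esub> u = s \<oplus>\<^bsub>sec E V\<^esub> (t \<oplus>\<^bsub>sec E V\<^esub> u)"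
      by (auto simp: glued_components_carrier assoc_add_vec[of _ r] intro!: restrict_ext)
  next
    fix s t assume "s \<in> carrier (sec E V)" "t \<in> carrier (sec E V)"
    then show "s \<oplus>\<^bsub>sec E V\<^esub> t = t \<oplus>\<^bsub>sec E V\<^esub> s"
      by (auto simp: glued_components_carrier comm_add_vec[of _ r] intro!: restrict_ext)
  qed (use V in \<open>auto simp: glued_zero glued_add\<close>)
  show "\<one>\<^bsub>struct_sheaf d V\<^esub> \<odot>\<^bsub>sec E V\<^esub> s = s" if "s \<in> carrier (sec E V)" for s
  proof -
    have "restrict_sec V 1 \<cdot>\<^sub>v s i = s i" if "i \<in> I" for i
      using section_vecs_one[OF glued_components[OF \<open>s \<in> _\<close> that]] by simp
    then show ?thesis
      using glued_extensional[OF that] by (intro extensionalityI[of _ I]) (auto simp: struct_sheaf_def)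
  qed
qed (auto simp: struct_sheaf_def glued_smult glued_components_carrier add_smult_distrib_vec
    smult_add_distrib_vec[of _ r] smult_smult_assoc intro!: restrict_ext)

lemma glued_presheaf: "module_presheaf d X E"
  unfolding module_presheaf_def
proof (intro conjI ballI)
  fix V assume "V \<in> opens_in d X"
  then have V: "openin (zariski d) V"
    by (simp add: opens_in_iff)
  then show "Module.module (struct_sheaf d V) (sec E V)"
    by (rule glued_module)
  have VV: "V \<in> opens_in d V"
    using V by (simp add: opens_in_iff)
  show "res E V V s = s" if "s \<in> carrier (sec E V)" for s
    using that glued_restrict[OF that VV]
    by (intro glued_eqI[of _ V]) (auto simp: vec_at_restrict[of _ r] glued_components_carrier)
  fix V' assume V': "V' \<in> opens_in d V"
  show "res E V V' s \<in> carrier (sec E V')" if "s \<in> carrier (sec E V)" for s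
    using glued_restrict[OF that V'] by simp
  show "res E V V' (s \<oplus>\<^bsub>sec E V\<^esub> t) = res E V V' s \<oplus>\<^bsub>sec E V'\<^esub> res E V V' t"
    if "s \<in> carrier (sec E V)" "t \<in> carrier (sec E V)" for s t
    using that
    by (auto intro!: restrict_ext vec_eq_pointwise[of _ r]
        simp: vec_at_restrict[of _ r] vec_at_add[of _ r] glued_components_carrier)
  show "res E V V' (a \<odot>\<^bsub>sec E V\<^esub> s) = restrict_sec V' a \<odot>\<^bsub>sec E V'\<^esub> res E V V' s"
    if "a \<in> sections d V" "s \<in> carrier (sec E V)" for a s
    using that
    by (auto intro!: restrict_ext vec_eq_pointwise[of _ r]
        simp: vec_at_restrict[of _ r] vec_at_smult glued_components_carrier restrict_sec_def smult_zero_right)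
  show "res E V' V'' (res E V V' s) = res E V V'' s"
    if "V'' \<in> opens_in d V'" "s \<in> carrier (sec E V)" for V'' s
    using that
    by (auto intro!: restrict_ext vec_eq_pointwise[of _ r]
        simp: vec_at_restrict[of _ r] glued_components_carrier opens_in_iff)
qed

text \<open>
  Sections are glued pointwise: the value at \<open>P\<close> is read off from any member of the family whose
  domain contains \<open>P\<close>.
\<close>

lemma glued_gluing:
  assumes opens: "\<V> \<subseteq> opens_in d X" and s: "\<And>V. V \<in> \<V> \<Longrightarrow> s V \<in> carrier (sec E V)"
    and agree: "\<And>V V'. V \<in> \<V> \<Longrightarrow> V' \<in> \<V> \<Longrightarrow> res E V (V \<inter> V') (s V) = res E V' (V \<inter> V') (s V')"
  shows "\<exists>!t. t \<in> carrier (sec E (\<Union>\<V>)) \<and> (\<forall>V\<in>\<V>. res E (\<Union>\<V>) V t = s V)"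
proof -
  have agree_at: "vec_at P (s V i) = vec_at P (s V' i)"
    if "V \<in> \<V>" "V' \<in> \<V>" "P \<in> V" "P \<in> V'" "i \<in> I" for V V' P i
  proof -
    have "restrict_vec (V \<inter> V') (s V i) = restrict_vec (V \<inter> V') (s V' i)"
      using fun_cong[OF agree[OF that(1,2)], of i] that(5) by simp
    then show ?thesis
      using that(3,4) restrict_vec_eq_iff[OF glued_components_carrier[OF s[OF that(1)] that(5)]
          glued_components_carrier[OF s[OF that(2)] that(5)], of "V \<inter> V'"] by blast
  qed
  have open_in: "V \<in> opens_in d (\<Union>\<V>)" if "V \<in> \<V>" for V
    using opens that by (auto simp: opens_in_iff)
  \<comment> \<open>off the union of the domains the value has to be the default \<open>0\<close> of the extension\<close>
  define c where "c P = (SOME V. V \<in> \<V> \<and> P \<in> V)" for P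
  define t where "t = (\<lambda>i\<in>I. vec r (\<lambda>k P. if P \<in> \<Union>\<V> then (s (c P) i $ k) P else 0))"
  have t_at: "vec_at P (t i) = vec_at P (s V i)" if "V \<in> \<V>" "P \<in> V" "i \<in> I" for V P i
  proof -
    have c: "c P \<in> \<V> \<and> P \<in> c P"
      unfolding c_def using that someI[of "\<lambda>V. V \<in> \<V> \<and> P \<in> V" V] by simp
    then have "vec_at P (t i) = vec_at P (s (c P) i)"
      using that glued_components_carrier[OF s, of "c P" i] by (intro eq_vecI) (auto simp: t_def)
    then show ?thesis
      using agree_at[of "c P" V P i] c that by simp
  qed
  have t_off: "vec_at P (t i) = 0\<^sub>v r" if "P \<notin> \<Union>\<V>" "i \<in> I" for P i
    using that by (intro eq_vecI) (auto simp: t_def)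
  have t: "t \<in> carrier (sec E (\<Union>\<V>))"
    unfolding glued_carrier_iff
  proof (intro conjI ballI)
    have "t i \<in> section_vecs d (\<Union>\<V> \<inter> W i) r" if i: "i \<in> I" for i
    proof (rule section_vecs_local)
      show "t i \<in> carrier_vec r"
        using i by (simp add: t_def)
      show "vec_at P (t i) = 0\<^sub>v r" if "P \<notin> \<Union>\<V> \<inter> W i" for P
      proof (cases "P \<in> \<Union>\<V>")
        case True
        then obtain V where V: "V \<in> \<V>" "P \<in> V"
          by blast
        then have "P \<notin> V \<inter> W i"
          using that by blast
        then show ?thesis
          using section_vecs_off[OF glued_components[OF s[OF V(1)] i]] t_at[OF V i] by simp
      qed (use t_off i in simp)
      show "\<exists>U w. P \<in> U \<and> U \<subseteq> \<Union>\<V> \<inter> W i \<and> w \<in> section_vecs d U r \<and>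
          (\<forall>Q\<in>U. vec_at Q (t i) = vec_at Q w)" if P: "P \<in> \<Union>\<V> \<inter> W i" for P
      proof -
        obtain V where V: "V \<in> \<V>" "P \<in> V"
          using P by blast
        then show ?thesis
          using P i glued_components[OF s[OF V(1)] i] t_at[OF V(1) _ i]
          by (intro exI[of _ "V \<inter> W i"] exI[of _ "s V i"]) auto
      qed
    qed
    then show "t \<in> (\<Pi>\<^sub>E i\<in>I. section_vecs d (\<Union>\<V> \<inter> W i) r)"
      by (simp add: PiE_iff) (simp add: t_def)
  next
    fix i j P assume ij: "i \<in> I" "j \<in> I" and P: "P \<in> \<Union>\<V> \<inter> W i \<inter> W j"
    then obtain V where V: "V \<in> \<V>" "P \<in> V"
      by blast
    then show "vec_at P (t i) = mat_at P (g i j) *\<^sub>v vec_at P (t j)"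
      using glued_compatible[OF s[OF V(1)] ij V(2)] P t_at[OF V] ij by simp
  qed
  show ?thesis
  proof (rule ex1I[of _ t], intro conjI ballI t)
    fix V assume V: "V \<in> \<V>"
    show "res E (\<Union>\<V>) V t = s V"
      using glued_restrict[OF t open_in[OF V]] s[OF V] t_at[OF V] t
      by (intro glued_eqI[of _ V]) (auto simp: vec_at_restrict[of _ r] glued_components_carrier)
  next
    fix t' assume t': "t' \<in> carrier (sec E (\<Union>\<V>)) \<and> (\<forall>V\<in>\<V>. res E (\<Union>\<V>) V t' = s V)"
    show "t' = t"
    proof (rule glued_eqI)
      fix i P assume i: "i \<in> I" and "P \<in> \<Union>\<V>"
      then obtain V where V: "V \<in> \<V>" "P \<in> V"
        by blast
      have "s V i = restrict_vec V (t' i)"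
        using fun_cong[OF bspec[OF conjunct2[OF t'] V(1)], of i] i by simp
      then have "vec_at P (s V i) = vec_at P (t' i)"
        using V(2) glued_components_carrier[OF conjunct1[OF t'] i] by (simp add: vec_at_restrict[of _ r])
      then show "vec_at P (t' i) = vec_at P (t i)"
        using t_at[OF V i] by simp
    qed (use t t' in auto)
  qed
qed

lemma glued_sheaf: "module_sheaf d X E"
  unfolding module_sheaf_def
proof (intro conjI allI impI glued_presheaf)
  fix \<V> s
  assume "\<V> \<subseteq> opens_in d X" "\<forall>V\<in>\<V>. s V \<in> carrier (sec E V)"
    "\<forall>V\<in>\<V>. \<forall>V'\<in>\<V>. res E V (V \<inter> V') (s V) = res E V' (V \<inter> V') (s V')"
  then show "\<exists>!t. t \<in> carrier (sec E (\<Union>\<V>)) \<and> (\<forall>V\<in>\<V>. res E (\<Union>\<V>) V t = s V)"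
    by (intro glued_gluing[of \<V> X s]) blast+
qed

end

section \<open>Coboundaries glue to trivial bundles\<close>

text \<open>
  A cocycle of the form \<open>g i j = h i * inverse (h j)\<close>. The inverse \<open>h' i\<close> is part of the data because its
  entries, too, have to be regular on all of \<open>W i\<close>.
\<close>

locale coboundary_data = gluing_data +
  fixes h h'
  assumes h_sections: "i \<in> I \<Longrightarrow> h i \<in> sections_mat d (W i) r"
    and h'_sections: "i \<in> I \<Longrightarrow> h' i \<in> sections_mat d (W i) r"
    and h_inverse: "i \<in> I \<Longrightarrow> P \<in> W i \<Longrightarrow> mat_at P (h i) * mat_at P (h' i) = 1\<^sub>m r"
      "i \<in> I \<Longrightarrow> P \<in> W i \<Longrightarrow> mat_at P (h' i) * mat_at P (h i) = 1\<^sub>m r"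
    and g_coboundary: "i \<in> I \<Longrightarrow> j \<in> I \<Longrightarrow> P \<in> W i \<Longrightarrow> P \<in> W j \<Longrightarrow>
      mat_at P (g i j) = mat_at P (h i) * mat_at P (h' j)"
begin

lemma h_carrier: "i \<in> I \<Longrightarrow> h i \<in> carrier_mat r r"
  and h'_carrier: "i \<in> I \<Longrightarrow> h' i \<in> carrier_mat r r"
  using h_sections h'_sections by (auto simp: sections_mat_def)

lemma h_cancel:
  assumes "i \<in> I" and "P \<in> W i" and "v \<in> carrier_vec r"
  shows "mat_at P (h i) *\<^sub>v (mat_at P (h' i) *\<^sub>v v) = v"
    and "mat_at P (h' i) *\<^sub>v (mat_at P (h i) *\<^sub>v v) = v"
  using assms h_carrier[OF assms(1)] h'_carrier[OF assms(1)] h_inverse[OF assms(1,2)]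
  by (simp_all add: assoc_mult_mat_vec[of _ r r _ r, symmetric])

definition index_at :: "'a pt \<Rightarrow> nat" where
  "index_at P = (SOME i. i \<in> I \<and> P \<in> W i)"

text \<open>
  The coordinates of a section \<open>s\<close> in the global frame are \<open>h' i\<close> applied to \<open>s i\<close>. Because the
  result is independent of \<open>i\<close>, it may be computed at each point in an arbitrary member of the cover.
\<close>

definition frame_coords :: "'a pt set \<Rightarrow> (nat \<Rightarrow> 'a regf vec) \<Rightarrow> 'a regf vec" where
  "frame_coords V s = vec r (\<lambda>k P. if P \<in> V
     then ((h' (index_at P) *\<^sub>v s (index_at P)) $ k) P else 0)"

definition from_frame :: "'a regf vec \<Rightarrow> nat \<Rightarrow> 'a regf vec" where
  "from_frame v = (\<lambda>i\<in>I. h i *\<^sub>v v)"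

text \<open>
  Multiply the gluing relation \<open>s i = h i * h' j * s j\<close> by \<open>h' i\<close>.
\<close>

lemma coords_compatible:
  assumes s: "s \<in> carrier (sec E V)" and ij: "i \<in> I" "j \<in> I" and P: "P \<in> V" "P \<in> W i" "P \<in> W j"
  shows "mat_at P (h' i) *\<^sub>v vec_at P (s i) = mat_at P (h' j) *\<^sub>v vec_at P (s j)"
proof -
  have "vec_at P (s i) = mat_at P (h i) *\<^sub>v (mat_at P (h' j) *\<^sub>v vec_at P (s j))"
    using glued_compatible[OF s ij P] g_coboundary[OF ij P(2,3)] h_carrier[OF ij(1)] h'_carrier[OF ij(2)]
      glued_components_carrier[OF s ij(2)]
    by (simp add: assoc_mult_mat_vec[of _ r r _ r])
  moreover have "mat_at P (h' j) *\<^sub>v vec_at P (s j) \<in> carrier_vec r"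
    using h'_carrier[OF ij(2)] glued_components_carrier[OF s ij(2)]
    by (intro mult_mat_vec_carrier[of _ r r]) auto
  ultimately show ?thesis
    using h_cancel(2)[OF ij(1) P(2)] by simp
qed

lemma frame_coords_carrier [simp]: "frame_coords V s \<in> carrier_vec r"
  by (simp add: frame_coords_def)

lemma frame_coords_at:
  assumes s: "s \<in> carrier (sec E V)" and i: "i \<in> I" and P: "P \<in> V" "P \<in> W i"
  shows "vec_at P (frame_coords V s) = mat_at P (h' i) *\<^sub>v vec_at P (s i)"
proof -
  let ?j = "index_at P"
  have j: "?j \<in> I" "P \<in> W ?j"
    using someI[of "\<lambda>i. i \<in> I \<and> P \<in> W i" i] i P by (auto simp: index_at_def)
  have "vec_at P (frame_coords V s) = vec_at P (h' ?j *\<^sub>v s ?j)"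
    using P h'_carrier[OF j(1)] by (intro eq_vecI) (auto simp: frame_coords_def)
  also have "\<dots> = mat_at P (h' ?j) *\<^sub>v vec_at P (s ?j)"
    using h'_carrier[OF j(1)] glued_components_carrier[OF s j(1)] by (rule vec_at_mult)
  also have "\<dots> = mat_at P (h' i) *\<^sub>v vec_at P (s i)"
    by (rule coords_compatible[OF s j(1) i P(1) j(2) P(2)])
  finally show ?thesis .
qed

lemma frame_coords_section:
  assumes V: "V \<in> opens_in d (\<Union>i\<in>I. W i)" and s: "s \<in> carrier (sec E V)"
  shows "frame_coords V s \<in> section_vecs d V r"
proof (rule section_vecs_local)
  fix P assume "P \<in> V"
  then obtain i where i: "i \<in> I" "P \<in> W i"
    using V by (auto simp: opens_in_iff)
  have U: "W i \<inter> (V \<inter> W i) = V \<inter> W i" "openin (zariski d) (V \<inter> W i)"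
    using V W_open[OF i(1)] by (auto simp: opens_in_iff)
  have "h' i *\<^sub>v s i \<in> section_vecs d (V \<inter> W i) r"
    using section_vecs_mult[OF h'_sections[OF i(1)] glued_components[OF s i(1)]] U by simp
  moreover have "\<forall>Q\<in>V \<inter> W i. vec_at Q (frame_coords V s) = vec_at Q (h' i *\<^sub>v s i)"
    using frame_coords_at[OF s i(1)] vec_at_mult[OF h'_carrier[OF i(1)] glued_components_carrier[OF s i(1)]]
    by simp
  ultimately show "\<exists>U w. P \<in> U \<and> U \<subseteq> V \<and> w \<in> section_vecs d U r \<and>
      (\<forall>Q\<in>U. vec_at Q (frame_coords V s) = vec_at Q w)"
    using \<open>P \<in> V\<close> i by (intro exI[of _ "V \<inter> W i"] exI[of _ "h' i *\<^sub>v s i"]) auto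
next
  show "vec_at P (frame_coords V s) = 0\<^sub>v r" if "P \<notin> V" for P
    using that by (intro eq_vecI) (auto simp: frame_coords_def)
qed simp

lemma from_frame_at:
  "v \<in> carrier_vec r \<Longrightarrow> i \<in> I \<Longrightarrow> vec_at P (from_frame v i) = mat_at P (h i) *\<^sub>v vec_at P v"
  using vec_at_mult[OF h_carrier] by (simp add: from_frame_def)

lemma from_frame_section:
  assumes V: "openin (zariski d) V" and v: "v \<in> section_vecs d V r"
  shows "from_frame v \<in> carrier (sec E V)"
  unfolding glued_carrier_iff
proof (intro conjI ballI)
  have "h i *\<^sub>v v \<in> section_vecs d (V \<inter> W i) r" if "i \<in> I" for i
    using section_vecs_mult[OF h_sections[OF that] v] V W_open[OF that]
    by (simp add: Int_commute openin_Int)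
  then show "from_frame v \<in> (\<Pi>\<^sub>E i\<in>I. section_vecs d (V \<inter> W i) r)"
    by (simp add: from_frame_def)
next
  fix i j P assume ij: "i \<in> I" "j \<in> I" and P: "P \<in> V \<inter> W i \<inter> W j"
  have v': "v \<in> carrier_vec r"
    using v by (rule section_vecs_carrier)
  have hv: "mat_at P (h j) *\<^sub>v vec_at P v \<in> carrier_vec r"
    using h_carrier[OF ij(2)] v' by (intro mult_mat_vec_carrier[of _ r r]) auto
  have "mat_at P (g i j) *\<^sub>v (mat_at P (h j) *\<^sub>v vec_at P v) =
      mat_at P (h i) *\<^sub>v (mat_at P (h' j) *\<^sub>v (mat_at P (h j) *\<^sub>v vec_at P v))"
    using g_coboundary[OF ij] P hv h_carrier[OF ij(1)] h'_carrier[OF ij(2)]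
    by (simp add: assoc_mult_mat_vec[of _ r r _ r])
  also have "\<dots> = mat_at P (h i) *\<^sub>v vec_at P v"
    using h_cancel(2)[OF ij(2)] P v' by simp
  finally show "vec_at P (from_frame v i) = mat_at P (g i j) *\<^sub>v vec_at P (from_frame v j)"
    using from_frame_at[OF v'] ij by simp
qed

text \<open>
  Passing to frame coordinates is an isomorphism over every open set, inverse to \<open>v \<mapsto> (h i * v)\<close>;
  all the compatibilities are linear identities between values.
\<close>

lemma coboundary_trivial: "module_iso d (\<Union>i\<in>I. W i) E (free_module d r)"
  unfolding module_iso_def
proof (intro exI[of _ frame_coords] ballI conjI)
  fix V assume V: "V \<in> opens_in d (\<Union>i\<in>I. W i)"
  then have V_open: "openin (zariski d) V" and cover: "\<And>P. P \<in> V \<Longrightarrow> \<exists>i\<in>I. P \<in> W i"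
    by (auto simp: opens_in_iff)
  note mult_carrier = mult_mat_vec_carrier[of _ r r]
  show "bij_betw (frame_coords V) (carrier (sec E V)) (carrier (sec (free_module d r) V))"
  proof (rule bij_betw_byWitness[of _ from_frame])
    show "\<forall>s\<in>carrier (sec E V). from_frame (frame_coords V s) = s"
    proof
      fix s assume s: "s \<in> carrier (sec E V)"
      show "from_frame (frame_coords V s) = s"
        using s V_open h_cancel(1) frame_coords_at[OF s] glued_components_carrier[OF s]
        by (intro glued_eqI[of _ V] from_frame_section frame_coords_section[OF V])
          (auto simp: from_frame_at)
    qed
    show "\<forall>v\<in>carrier (sec (free_module d r) V). frame_coords V (from_frame v) = v"
    proof
      fix v assume "v \<in> carrier (sec (free_module d r) V)"
      then have v: "v \<in> section_vecs d V r"
        by simp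
      note s = from_frame_section[OF V_open v]
      show "frame_coords V (from_frame v) = v"
      proof (rule section_vecs_eqI[OF frame_coords_section[OF V s] v])
        fix P assume "P \<in> V"
        then obtain i where "i \<in> I" "P \<in> W i"
          using cover by blast
        then show "vec_at P (frame_coords V (from_frame v)) = vec_at P v"
          using \<open>P \<in> V\<close> frame_coords_at[OF s] section_vecs_carrier[OF v]
          by (simp add: from_frame_at h_cancel(2))
      qed
    qed
  qed (use V V_open in \<open>auto simp: frame_coords_section from_frame_section\<close>)
  {
    fix s t assume st: "s \<in> carrier (sec E V)" "t \<in> carrier (sec E V)"
    have "frame_coords V (\<lambda>i\<in>I. s i + t i) = frame_coords V s + frame_coords V t"
    proof (rule section_vecs_eqI)
      fix P assume P: "P \<in> V"
      then obtain i where i: "i \<in> I" "P \<in> W i"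
        using cover by blast
      then show "vec_at P (frame_coords V (\<lambda>i\<in>I. s i + t i)) = vec_at P (frame_coords V s + frame_coords V t)"
        using st P h'_carrier[OF i(1)] frame_coords_at[OF st(1) i(1) P i(2)]
          frame_coords_at[OF st(2) i(1) P i(2)] frame_coords_at[OF glued_add[OF st] i(1) P i(2)]
        by (simp add: vec_at_add[of _ r] glued_components_carrier mult_add_distrib_mat_vec[of _ r r])
    qed (use st V in \<open>auto intro!: frame_coords_section section_vecs_add glued_add\<close>)
    then show "frame_coords V (s \<oplus>\<^bsub>sec E V\<^esub> t) =
        frame_coords V s \<oplus>\<^bsub>sec (free_module d r) V\<^esub> frame_coords V t"
      by simp
  next
    fix a s assume as: "a \<in> sections d V" "s \<in> carrier (sec E V)"
    have "frame_coords V (\<lambda>i\<in>I. a \<cdot>\<^sub>v s i) = a \<cdot>\<^sub>v frame_coords V s"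
    proof (rule section_vecs_eqI)
      fix P assume P: "P \<in> V"
      then obtain i where i: "i \<in> I" "P \<in> W i"
        using cover by blast
      then show "vec_at P (frame_coords V (\<lambda>i\<in>I. a \<cdot>\<^sub>v s i)) = vec_at P (a \<cdot>\<^sub>v frame_coords V s)"
        using as P h'_carrier[OF i(1)] frame_coords_at[OF as(2) i(1) P i(2)]
          frame_coords_at[OF glued_smult[OF as] i(1) P i(2)]
        by (simp add: vec_at_smult glued_components_carrier mult_mat_vec[of _ r r])
    next
      show "a \<cdot>\<^sub>v frame_coords V s \<in> section_vecs d V r"
        using section_vecs_smult[OF as(1) frame_coords_section[OF V as(2)]] by simp
    qed (use as V in \<open>auto intro!: frame_coords_section glued_smult\<close>)
    then show "frame_coords V (a \<odot>\<^bsub>sec E V\<^esub> s) = a \<odot>\<^bsub>sec (free_module d r) V\<^esub> frame_coords V s"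
      by simp
  next
    fix V' s assume V': "V' \<in> opens_in d V" and s: "s \<in> carrier (sec E V)"
    then have V'X: "V' \<in> opens_in d (\<Union>i\<in>I. W i)" and sub: "V' \<subseteq> V"
      using V by (auto simp: opens_in_iff)
    note s' = glued_restrict[OF s V']
    have "frame_coords V' (\<lambda>i\<in>I. restrict_vec V' (s i)) = restrict_vec V' (frame_coords V s)"
    proof (rule section_vecs_eqI[OF frame_coords_section[OF V'X s']])
      have "V \<inter> V' = V'"
        using sub by blast
      then show "restrict_vec V' (frame_coords V s) \<in> section_vecs d V' r"
        using section_vecs_restrict[OF frame_coords_section[OF V s], of V'] V' by (simp add: opens_in_iff)
    next
      fix P assume P: "P \<in> V'"
      then obtain i where i: "i \<in> I" "P \<in> W i"
        using cover sub by blast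
      then show "vec_at P (frame_coords V' (\<lambda>i\<in>I. restrict_vec V' (s i))) =
          vec_at P (restrict_vec V' (frame_coords V s))"
        using s P sub frame_coords_at[OF s i(1) _ i(2)] frame_coords_at[OF s' i(1) P i(2)]
        by (auto simp: vec_at_restrict[of _ r] glued_components_carrier)
    qed
    then show "frame_coords V' (res E V V' s) = res (free_module d r) V V' (frame_coords V s)"
      by simp
  }
qed

end

section \<open>Invertible matrices of fractions\<close>

definition fraction_mats :: "nat \<Rightarrow> 'f::field pt set \<Rightarrow> nat \<Rightarrow> 'f ratf mat set" where
  "fraction_mats d V r =
     {A \<in> carrier_mat r r. \<forall>k<r. \<forall>l<r. fraction_on d V (A $$ (k, l))}"

lemma fraction_mats_carrier: "A \<in> fraction_mats d V r \<Longrightarrow> A \<in> carrier_mat r r"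
  by (simp add: fraction_mats_def)

lemma fraction_mats_mono: "A \<in> fraction_mats d V r \<Longrightarrow> V' \<subseteq> V \<Longrightarrow> A \<in> fraction_mats d V' r"
  by (auto simp: fraction_mats_def intro: fraction_on_mono)

lemma fraction_mats_mult:
  assumes V: "V \<subseteq> Proj d" and A: "A \<in> fraction_mats d V r" and B: "B \<in> fraction_mats d V r"
  shows "A * B \<in> fraction_mats d V r"
proof -
  have "fraction_on d V ((A * B) $$ (k, l))" if "k < r" "l < r" for k l
  proof -
    have "(A * B) $$ (k, l) = (\<Sum>t<r. A $$ (k, t) * B $$ (t, l))"
      using A B that by (auto simp: fraction_mats_def scalar_prod_def atLeast0LessThan intro!: sum.cong)
    also have "fraction_on d V \<dots>"
      using A B that V by (intro fraction_on_sum fraction_on_mult) (auto simp: fraction_mats_def)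
    finally show ?thesis .
  qed
  moreover have "A * B \<in> carrier_mat r r"
    using A[THEN fraction_mats_carrier] B[THEN fraction_mats_carrier] by (rule mult_carrier_mat)
  ultimately show ?thesis
    by (simp add: fraction_mats_def)
qed

lemma fraction_mats_transpose: "A \<in> fraction_mats d V r \<Longrightarrow> A\<^sup>T \<in> fraction_mats d V r"
  by (auto simp add: fraction_mats_def)

lemma fraction_mats_smult:
  "V \<subseteq> Proj d \<Longrightarrow> fraction_on d V f \<Longrightarrow> A \<in> fraction_mats d V r \<Longrightarrow> f \<cdot>\<^sub>m A \<in> fraction_mats d V r"
  by (auto simp: fraction_mats_def intro!: fraction_on_mult)

lemma fraction_mats_cst:
  "V \<subseteq> Proj d \<Longrightarrow> A \<in> carrier_mat r r \<Longrightarrow> map_mat cst A \<in> fraction_mats d V r"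
  by (auto simp: fraction_mats_def fraction_on_cst)

lemma section_mat_sections:
  "openin (zariski d) V \<Longrightarrow> A \<in> fraction_mats d V r \<Longrightarrow> section_mat V A \<in> sections_mat d V r"
  by (auto simp: fraction_mats_def sections_mat_def section_mat_def sections_fraction)

lemma section_mat_GL:
  assumes V: "openin (zariski d) V" and A: "A \<in> fraction_mats d V r" and B: "B \<in> fraction_mats d V r"
    and AB: "A * B = 1\<^sub>m r" and BA: "B * A = 1\<^sub>m r"
  shows "section_mat V A \<in> GL d V r"
proof -
  have "section_mat V A * section_mat V B = restrict_mat V (1\<^sub>m r)"
    "section_mat V B * section_mat V A = restrict_mat V (1\<^sub>m r)"
    using fraction_mats_carrier[OF A] fraction_mats_carrier[OF B]
    by (simp_all add: section_mat_mult[of _ r r] AB BA section_mat_one)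
  then show ?thesis
    using section_mat_sections[OF V A] section_mat_sections[OF V B] by (auto simp: GL_def)
qed

text \<open>
  A similitude of a nondegenerate form is inverted by its adjoint with respect to the form, divided
  by the multiplier; \<open>C\<close> is the inverse of the Gram matrix \<open>B\<close>.
\<close>

lemma similitude_inverse:
  fixes M B C :: "'k::field mat"
  assumes M: "M \<in> carrier_mat n n" and B: "B \<in> carrier_mat n n" and C: "C \<in> carrier_mat n n"
    and CB: "C * B = 1\<^sub>m n" and sim: "M\<^sup>T * (B * M) = c \<cdot>\<^sub>m B" and c: "c \<noteq> 0"
  defines "M' \<equiv> inverse c \<cdot>\<^sub>m (C * (M\<^sup>T * B))"
  shows "M' * M = 1\<^sub>m n" and "M * M' = 1\<^sub>m n"
proof -
  have MT: "M\<^sup>T \<in> carrier_mat n n"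
    using M by simp
  have "M' * M = inverse c \<cdot>\<^sub>m (C * (M\<^sup>T * (B * M)))"
    unfolding M'_def using M B C MT
    by (simp add: mult_smult_assoc_mat[of _ n n _ n] assoc_mult_mat[of _ n n _ n _ n])
  also have "\<dots> = inverse c \<cdot>\<^sub>m (c \<cdot>\<^sub>m 1\<^sub>m n)"
    unfolding sim using B C CB by (simp add: mult_smult_distrib[of _ n n _ n])
  also have "\<dots> = 1\<^sub>m n"
    using c by (intro eq_matI) auto
  finally show "M' * M = 1\<^sub>m n" .
  then show "M * M' = 1\<^sub>m n"
    using M B C MT by (intro mat_mult_left_right_inverse[of M' n M]) (auto simp: M'_def)
qed

section \<open>The deletion element and its norm\<close>

lemma Var_nonzero: "Var k \<noteq> (0 :: 'f::field hpoly)"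
proof
  assume "Var k = (0 :: 'f hpoly)"
  then have "Poly_Mapping.lookup (Var k :: 'f hpoly) (Poly_Mapping.single k 1) = 0"
    by simp
  then show False
    by (simp add: Var_def)
qed

lemma fraction_on_deletion:
  assumes "i \<le> d" and "r < d" and "U \<subseteq> chart d i"
  shows "fraction_on d U (deletion i r)"
  unfolding deletion_def
proof (rule fraction_onI)
  show "Var (skip i r) \<in> Hom d 1" "Var i \<in> Hom d 1"
    using assms by (auto intro!: Hom_Var simp del: One_nat_def simp: skip_def)
qed (use assms in \<open>auto simp: Var_nonzero chart_def basic_open_def\<close>)

lemma chart_open: "i \<le> d \<Longrightarrow> openin (zariski d) (chart d i)"
  unfolding chart_def by (intro openin_basic_open[OF Hom_Var])

lemma chart_Proj: "chart d i \<subseteq> Proj d"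
  by (auto simp: chart_def basic_open_def)

lemma fraction_on_norm_deletion:
  assumes "i \<le> d"
  shows "fraction_on d (chart d i) (norm_ext N d e cst (deletion i))"
  unfolding norm_ext_def power2_eq_square using chart_Proj assms
  by (intro fraction_on_add fraction_on_sum fraction_on_mult fraction_on_cst fraction_on_deletion) auto

lemma M_del_fraction:
  assumes "i \<le> d" and "U \<subseteq> chart d i"
  shows "M_del scale mul d e i \<in> fraction_mats d U d"
proof -
  have "fraction_on d U (\<Sum>t<d. cst (f t) * deletion i t)" for f
    using assms chart_Proj[of d i]
    by (intro fraction_on_sum fraction_on_mult fraction_on_cst fraction_on_deletion) auto
  then show ?thesis
    by (simp add: M_del_def left_mult_mat_def fraction_mats_def)
qed

lemma W_del_open: "i \<le> d \<Longrightarrow> openin (zariski d) (W_del N d e i)"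
  unfolding W_del_def by (intro openin_nonvanishing chart_open fraction_on_norm_deletion)

lemma single_pair_eq:
  assumes "Poly_Mapping.single a 1 + Poly_Mapping.single b 1 = Poly_Mapping.single k (2::nat)"
  shows "a = k \<and> b = k"
proof -
  have "Poly_Mapping.lookup (Poly_Mapping.single a 1 + Poly_Mapping.single b 1) k = (2::nat)"
    by (simp only: assms lookup_single_eq)
  then show ?thesis
    by (auto simp: lookup_add lookup_single when_def split: if_splits)
qed

text \<open>
  After clearing the denominator \<open>Var i ^ 2\<close>, the coefficient of the square of the first remaining
  variable is \<open>N (e 0)\<close>. This guarantees that the matrix of the deletion element is invertible over
  the function field whether or not the open set \<open>W_del N d e i\<close> has points.
\<close>

lemma norm_deletion_nonzero:
  fixes N :: "'d::ab_group_add \<Rightarrow> 'f::field"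
  assumes "0 < d" and "N (e 0) \<noteq> 0"
  shows "norm_ext N d e cst (deletion i) \<noteq> 0"
proof
  assume zero: "norm_ext N d e cst (deletion i) = 0"
  define \<iota> :: "'f hpoly \<Rightarrow> 'f ratf" where "\<iota> p = Fraction_Field.Fract p 1" for p
  define mon :: "nat \<Rightarrow> nat \<Rightarrow> (nat \<Rightarrow>\<^sub>0 nat)" where
    "mon r s = Poly_Mapping.single (skip i r) 1 + Poly_Mapping.single (skip i s) 1" for r s
  define F where "F = (\<Sum>r<d. Poly_Mapping.single (mon r r) (N (e r))) +
      (\<Sum>s<d. \<Sum>r<s. Poly_Mapping.single (mon r s) (polar N (e r) (e s)))"
  have \<iota>_add: "\<iota> (p + q) = \<iota> p + \<iota> q" for p q
    by (simp add: \<iota>_def)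
  have \<iota>_zero: "\<iota> 0 = 0"
    by (simp add: \<iota>_def Zero_fract_def)
  have \<iota>_sum: "\<iota> (sum f A) = (\<Sum>x\<in>A. \<iota> (f x))" for f and A :: "nat set"
    by (induction A rule: infinite_finite_induct) (simp_all add: \<iota>_zero \<iota>_add)
  have monomial: "\<iota> (Var i * Var i) * (cst c * (deletion i r * deletion i s)) =
      \<iota> (Poly_Mapping.single (mon r s) c)" for c r s
  proof -
    have "Poly_Mapping.single 0 c * (Var (skip i r) * Var (skip i s)) = Poly_Mapping.single (mon r s) c"
      by (simp add: Var_def mult_single mon_def)
    then show ?thesis
      by (simp add: \<iota>_def cst_def deletion_def eq_fract Var_nonzero ac_simps)
  qed
  have "\<iota> (Var i * Var i) * norm_ext N d e cst (deletion i) = \<iota> F"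
    by (simp add: norm_ext_def F_def \<iota>_add \<iota>_sum distrib_left sum_distrib_left power2_eq_square monomial)
  then have "\<iota> F = 0"
    by (simp add: zero)
  then have "F = 0"
    by (simp add: \<iota>_def Zero_fract_def eq_fract)
  moreover have "Poly_Mapping.lookup F (Poly_Mapping.single (skip i 0) 2) = N (e 0)"
  proof -
    have inj: "skip i r = skip i 0 \<longleftrightarrow> r = 0" for r
      by (auto simp: skip_def)
    have coeff: "Poly_Mapping.lookup (Poly_Mapping.single (mon r s) c) (Poly_Mapping.single (skip i 0) 2) =
        (if r = 0 \<and> s = 0 then c else 0)" for r s and c :: 'f
    proof (cases "r = 0 \<and> s = 0")
      case True
      then show ?thesis
        by (simp add: mon_def single_add[symmetric] numeral_2_eq_2)
    next
      case False
      then have "mon r s \<noteq> Poly_Mapping.single (skip i 0) 2"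
        using single_pair_eq[of "skip i r" "skip i s" "skip i 0"] inj by (auto simp: mon_def)
      then show ?thesis
        using False by (auto simp: lookup_single_not_eq)
    qed
    have "(\<Sum>r<d. if r = 0 \<and> r = 0 then N (e r) else 0) = N (e 0)"
      using \<open>0 < d\<close> by (simp add: sum.delta)
    moreover have "(\<Sum>s<d. \<Sum>r<s. if r = 0 \<and> s = 0 then polar N (e r) (e s) else 0) = 0"
      by (intro sum.neutral ballI) auto
    ultimately show ?thesis
      by (simp only: F_def lookup_add lookup_sum coeff add_0_right)
  qed
  ultimately show False
    using assms(2) by simp
qed

section \<open>Triviality of the bundle of a composition division algebra\<close>

theorem proposition8p2:
  fixes scale :: "'f::field \<Rightarrow> 'd::ab_group_add \<Rightarrow> 'd"
    and mul :: "'d \<Rightarrow> 'd \<Rightarrow> 'd"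
    and unit :: 'd
    and N :: "'d \<Rightarrow> 'f"
    and e :: "nat \<Rightarrow> 'd"
    and d :: nat
  assumes "CHAR('f) \<noteq> 2"
    and "composition_division_algebra scale mul unit N"
    and "d \<in> {2, 4, 8}"
    and "ordered_basis scale d e"
  shows "let W = W_del N d e; X = X_del N d e; g = transition scale mul N d e;
           E = glued_bundle d {..d} W d g
         in (\<forall>i\<le>d. openin (zariski d) (W i) \<and>
               section_mat (W i) (M_del scale mul d e i) \<in> GL d (W i) d) \<and>
            cocycle d {..d} W d g \<and> vector_bundle d X d E \<and> trivial_bundle d X d E"
proof -
  interpret D: composition_division_algebra scale mul unit N
    by fact
  have d: "0 < d"
    using assms(3) by auto
  have basis: "ordered_basis scale d e"
    by fact
  define W where "W = W_del N d e"
  define X where "X = X_del N d e"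
  define g where "g = transition scale mul N d e"
  define M where "M = M_del scale mul d e"
  define n :: "nat \<Rightarrow> 'f ratf" where "n i = norm_ext N d e cst (deletion i)" for i
  define B :: "'f ratf mat" where "B = map_mat cst (gram_mat N d e)"
  have B: "B \<in> carrier_mat d d"
    by (simp add: B_def)
  obtain C0 where C0: "C0 \<in> carrier_mat d d" "C0 * gram_mat N d e = 1\<^sub>m d"
    using D.gram_mat_invertible[OF basis] by blast
  define C :: "'f ratf mat" where "C = map_mat cst C0"
  have C: "C \<in> carrier_mat d d"
    using C0 by (simp add: C_def)
  interpret cst: comm_ring_hom "cst :: 'f \<Rightarrow> 'f ratf"
    by (rule cst_hom)
  have CB: "C * B = 1\<^sub>m d"
    unfolding C_def B_def
    by (simp add: cst.mat_hom_mult[OF C0(1) gram_mat_carrier, symmetric] C0(2) cst.mat_hom_one)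
  define M' where "M' i = inverse (n i) \<cdot>\<^sub>m (C * ((M i)\<^sup>T * B))" for i

  have "e 0 \<noteq> 0"
  proof
    assume "e 0 = 0"
    moreover have "e 0 \<in> e ` {..<d}"
      using d by blast
    ultimately show False
      using basis D.dependent_zero[of "e ` {..<d}"] by (simp add: ordered_basis_def)
  qed
  then have n: "n i \<noteq> 0" for i
    unfolding n_def using d by (intro norm_deletion_nonzero D.norm_nonzero)
  have M: "M i \<in> carrier_mat d d" for i
    by (simp add: M_def M_del_def)
  then have M': "M' i \<in> carrier_mat d d" for i
    unfolding M'_def using B C M[of i]
    by (intro smult_carrier_mat mult_carrier_mat[of _ d d]) simp_all
  have sim: "(M i)\<^sup>T * (B * M i) = n i \<cdot>\<^sub>m B" for i
    unfolding M_def M_del_def B_def n_def by (rule D.left_mult_similitude[OF cst_hom basis])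
  have M'M: "M' i * M i = 1\<^sub>m d" and MM': "M i * M' i = 1\<^sub>m d" for i
    unfolding M'_def using similitude_inverse[OF M B C CB sim n] by this+
  \<comment> \<open>a genuine inverse, since the norm of the deletion element is nonzero for every \<open>i\<close>\<close>
  have inv: "inv\<^bsub>ring_mat TYPE('f ratf) d ()\<^esub> (M i) = M' i" for i
  proof -
    interpret R: ring "ring_mat TYPE('f ratf) d ()"
      by (rule ring_mat)
    show ?thesis
      using M M' MM' M'M by (intro R.inv_char) (simp_all add: ring_mat_simps)
  qed
  have g: "g i j = section_mat (W i \<inter> W j) (M i * M' j)" for i j
    by (simp add: g_def transition_def W_def inv[unfolded M_def] M_def)
  then have g_carrier: "g i j \<in> carrier_mat d d" for i j
    using mult_carrier_mat[OF M M'] by simp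

  have W_open: "openin (zariski d) (W i)" if "i \<le> d" for i
    unfolding W_def using that by (rule W_del_open)
  have W_chart: "W i \<subseteq> chart d i" for i
    by (auto simp: W_def W_del_def)
  have W_Proj: "W i \<subseteq> Proj d" for i
    using W_chart chart_Proj by blast
  have M_fraction: "M i \<in> fraction_mats d (W i) d" if "i \<le> d" for i
    unfolding M_def using that W_chart by (rule M_del_fraction)
  have "fraction_on d (W i) (inverse (n i))" if "i \<le> d" for i
  proof (rule fraction_on_inverse[OF W_Proj _ n])
    show "fraction_on d (W i) (n i)"
      unfolding n_def using fraction_on_norm_deletion[OF that] W_chart by (rule fraction_on_mono)
    show "n i \<notin> stalk_max_ideal d P" if "P \<in> W i" for P
      using that by (simp add: n_def W_def W_del_def)
  qed
  then have M'_fraction: "M' i \<in> fraction_mats d (W i) d" if "i \<le> d" for i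
    unfolding M'_def B_def C_def using that W_Proj M_fraction C0(1)
    by (intro fraction_mats_smult fraction_mats_mult fraction_mats_transpose fraction_mats_cst) auto
  have W_GL: "section_mat (W i) (M i) \<in> GL d (W i) d" if "i \<le> d" for i
    using that by (intro section_mat_GL[OF W_open M_fraction M'_fraction MM' M'M])

  have assoc: "M i * M' j * (M j * M' k) = M i * M' k" for i j k
  proof -
    have "M' j * (M j * M' k) = M' k"
      using assoc_mult_mat[OF M' M M', of j j k] left_mult_one_mat[OF M', of k] by (simp add: M'M)
    then show ?thesis
      using assoc_mult_mat[OF M M' mult_carrier_mat[OF M M'], of i j j k] by simp
  qed
  have g_fraction: "M i * M' j \<in> fraction_mats d (W i \<inter> W j) d" if "i \<le> d" "j \<le> d" for i j
    using that W_Proj[of i]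
    by (intro fraction_mats_mult fraction_mats_mono[OF M_fraction] fraction_mats_mono[OF M'_fraction]) auto
  have cocycle: "cocycle d {..d} W d g"
    unfolding cocycle_def
  proof (intro conjI ballI)
    fix i j assume "i \<in> {..d}" "j \<in> {..d}"
    then have ij: "i \<le> d" "j \<le> d"
      by auto
    have "M j * M' i \<in> fraction_mats d (W i \<inter> W j) d"
      using g_fraction[OF ij(2,1)] by (simp add: Int_commute)
    then show "g i j \<in> GL d (W i \<inter> W j) d"
      unfolding g using ij
      by (intro section_mat_GL[OF _ g_fraction]) (auto simp: assoc MM' W_open openin_Int)
  next
    show "g i i = restrict_mat (W i) (1\<^sub>m d)" for i
      by (simp add: g MM' section_mat_one)
  next
    fix i j k
    show "restrict_mat (W i \<inter> W j \<inter> W k) (g i j * g j k) = restrict_mat (W i \<inter> W j \<inter> W k) (g i k)"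
    proof (rule restrict_mat_eqI[OF mult_carrier_mat[OF g_carrier g_carrier] g_carrier])
      fix P assume "P \<in> W i \<inter> W j \<inter> W k"
      then show "mat_at P (g i j * g j k) = mat_at P (g i k)"
        by (simp add: mat_at_mult[OF g_carrier g_carrier]) (simp add: g mat_at_section assoc)
    qed
  qed

  interpret coboundary_data d "{..d}" W d g "\<lambda>i. section_mat (W i) (M i)" "\<lambda>i. section_mat (W i) (M' i)"
    using W_open g_carrier M_fraction M'_fraction
    by unfold_locales (auto simp: g mat_at_section MM' M'M intro!: section_mat_sections)
  have X: "X = (\<Union>i\<in>{..d}. W i)"
    by (simp add: X_def X_del_def W_def)
  have trivial: "module_iso d X (glued_bundle d {..d} W d g) (free_module d d)"
    unfolding X by (rule coboundary_trivial)
  have "openin (zariski d) X"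
    unfolding X using W_open by (intro openin_Union) auto
  \<comment> \<open>\<open>X\<close> itself serves as the trivializing neighbourhood of each of its points\<close>
  then have "X \<in> opens_in d X"
    by (simp add: opens_in_iff)
  then have "vector_bundle d X d (glued_bundle d {..d} W d g)"
    unfolding vector_bundle_def using glued_sheaf trivial by blast
  then show ?thesis
    unfolding Let_def W_def[symmetric] X_def[symmetric] g_def[symmetric] M_def[symmetric]
    using W_open W_GL cocycle trivial by (simp add: trivial_bundle_def)
qed

end
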